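(* Let $m\ge2$, $0=t_2<t_3<\dots<t_{m+1}$, $d_k=t_{k+2}-t_{k+1}$ for $k=1,\dots,m-1$, $d_0=d_m=0$, and let $\mathbf z(t)=\sum_{i=0}^m\mathbf z_iN^2_{i,\mu}(t)$, $\mathbf z_i\in\mathbb C$, over $\mu=\{\langle0\rangle^3<t_3<\dots<t_m<\langle t_{m+1}\rangle^3\}$. Let $\nu=\{\langle0\rangle^5<\langle t_3\rangle^3<\dots<\langle t_m\rangle^3<\langle t_{m+1}\rangle^5\}$ and $\rho=\{\langle0\rangle^6<\langle t_3\rangle^3<\dots<\langle t_m\rangle^3<\langle t_{m+1}\rangle^6\}$. Then $\mathbf z^2(t)=\sum_{k=0}^{3m-2}\mathbf p_kN^4_{k,\nu}(t)$ with $$\mathbf p_0=\mathbf z_0^2,\quad \mathbf p_1=\mathbf z_0\mathbf z_1,\quad \mathbf p_{3m-3}=\mathbf z_{m-1}\mathbf z_m,\quad \mathbf p_{3m-2}=\mathbf z_m^2,$$ $$\mathbf p_{3k-1}=\tfrac23\mathbf z_k^2+\tfrac13\Big(\tfrac{d_k\mathbf z_{k-1}+d_{k-1}\mathbf z_k}{d_{k-1}+d_k}\Big)\Big(\tfrac{d_{k+1}\mathbf z_k+d_k\mathbf z_{k+1}}{d_k+d_{k+1}}\Big)\ (1\le k\le m-1),$$ $$\mathbf p_{3k}=\mathbf z_k\tfrac{d_{k+1}\mathbf z_k+d_k\mathbf z_{k+1}}{d_k+d_{k+1}},\quad \mathbf p_{3k+1}=\mathbf z_{k+1}\tfrac{d_{k+1}\mathbf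 z_k+d_k\mathbf z_{k+1}}{d_k+d_{k+1}}\ (1\le k\le m-2).$$ The clamped quintic Pythagorean-Hodograph B-spline curve $\mathbf r(t)$, $t\in[t_2,t_{m+1}]$, with $\mathbf r'=\mathbf z^2$ is $\mathbf r(t)=\sum_{i=0}^{3m-1}\mathbf r_iN^5_{i,\rho}(t)$ with $\mathbf r_0$ arbitrary and $$\mathbf r_1=\mathbf r_0+\tfrac{d_1}5\mathbf z_0^2,\quad \mathbf r_2=\mathbf r_1+\tfrac{d_1}5\mathbf z_0\mathbf z_1,$$ $$\mathbf r_{3i}=\mathbf r_{3i-1}+\tfrac{d_i}5\Big(\tfrac23\mathbf z_i^2+\tfrac13\Big(\tfrac{d_i\mathbf z_{i-1}+d_{i-1}\mathbf z_i}{d_{i-1}+d_i}\Big)\Big(\tfrac{d_{i+1}\mathbf z_i+d_i\mathbf z_{i+1}}{d_i+d_{i+1}}\Big)\Big)\ (1\le i\le m-1),$$ $$\mathbf r_{3i+1}=\mathbf r_{3i}+\tfrac{\mathbf z_i}5(d_{i+1}\mathbf z_i+d_i\mathbf z_{i+1}),\quad \mathbf r_{3i+2}=\mathbf r_{3i+1}+\tfrac{\mathbf z_{i+1}}5(d_{i+1}\mathbf z_i+d_i\mathbf z_{i+1})\ (1\le i\le m-2),$$ $$\mathbf r_{3m-2}=\mathbf r_{3m-3}+\tfrac{d_{m-1}}5\mathbf z_{m-1}\mathbf z_m,\quad \mathbf r_{3m-1}=\mathbf r_{3m-2}+\tfrac{d_{m-1}}5\mathbf z_m^2.$$ Its total arc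 length is $L=l_{3m-1}$, where $l_0=0$, $l_1=l_0+\frac{d_1}5\mathbf z_0\bar{\mathbf z}_0$, $l_2=l_1+\frac{d_1}{10}(\mathbf z_0\bar{\mathbf z}_1+\mathbf z_1\bar{\mathbf z}_0)$, $$l_{3i}=l_{3i-1}+\tfrac{2d_i}{15}\mathbf z_i\bar{\mathbf z}_i+\tfrac{d_i}{15(d_{i-1}+d_i)(d_i+d_{i+1})}\Big(d_{i-1}d_{i+1}\mathbf z_i\bar{\mathbf z}_i+\tfrac{d_i^2}2(\mathbf z_{i-1}\bar{\mathbf z}_{i+1}+\mathbf z_{i+1}\bar{\mathbf z}_{i-1})+\tfrac{d_id_{i+1}}2(\mathbf z_{i-1}\bar{\mathbf z}_i+\mathbf z_i\bar{\mathbf z}_{i-1})+\tfrac{d_{i-1}d_i}2(\mathbf z_i\bar{\mathbf z}_{i+1}+\mathbf z_{i+1}\bar{\mathbf z}_i)\Big)$$ for $1\le i\le m-1$; for $1\le i\le m-2$, $l_{3i+1}=l_{3i}+\frac15\big(d_{i+1}\mathbf z_i\bar{\mathbf z}_i+\frac{d_i}2(\mathbf z_i\bar{\mathbf z}_{i+1}+\mathbf z_{i+1}\bar{\mathbf z}_i)\big)$ and $l_{3i+2}=l_{3i+1}+\frac15\big(d_i\mathbf z_{i+1}\bar{\mathbf z}_{i+1}+\frac{d_{i+1}}2(\mathbf z_i\bar{\mathbf z}_{i+1}+\mathbf z_{i+1}\bar{\mathbf z}_i)\big)$; $l_{3m-2}=l_{3m-3}+\frac{d_{m-1}}{10}(\mathbf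 z_{m-1}\bar{\mathbf z}_m+\mathbf z_m\bar{\mathbf z}_{m-1})$ and $l_{3m-1}=l_{3m-2}+\frac{d_{m-1}}5\mathbf z_m\bar{\mathbf z}_m$.
   Context: Normalized B-splines: for a nondecreasing knot sequence $\mu=\{t_i\}$, $N^0_{i,\mu}(t)=1$ if $t\in[t_i,t_{i+1})$ and $0$ otherwise, and $N^n_{i,\mu}(t)=\frac{t-t_i}{t_{i+n}-t_i}N^{n-1}_{i,\mu}(t)+\frac{t_{i+n+1}-t}{t_{i+n+1}-t_{i+1}}N^{n-1}_{i+1,\mu}(t)$ with $0/0=0$. Basis functions are indexed by the position (starting at $0$) of their first knot in the partition. $\langle t\rangle^k$ denotes the knot $t$ repeated $k$ times. At the right end of the domain, values are left limits. Points of $\mathbb R^2$ are identified with complex numbers. *)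

theory Defs
  imports "HOL-Analysis.Analysis"
begin

text \<open>
  The Cox--de Boor recursion over a nondecreasing knot list. The paper's convention
  \<open>0/0 = 0\<close> is HOL's \<open>x / 0 = 0\<close>: whenever a denominator below vanishes, the
  lower-order basis function it multiplies is identically zero.
\<close>

fun bspline_rec :: "real list \<Rightarrow> nat \<Rightarrow> nat \<Rightarrow> real \<Rightarrow> real" where
  "bspline_rec \<mu> 0 i x = (if x \<in> {\<mu> ! i ..< \<mu> ! (i + 1)} then 1 else 0)"
| "bspline_rec \<mu> (Suc n) i x =
     (x - \<mu> ! i) / (\<mu> ! (i + Suc n) - \<mu> ! i) * bspline_rec \<mu> n i x
   + (\<mu> ! (i + Suc n + 1) - x) / (\<mu> ! (i + Suc n + 1) - \<mu> ! (i + 1)) * bspline_rec \<mu> n (i + 1) x"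

text \<open>
  \<open>bspline \<mu> n i\<close> is \<open>N\<^sup>n\<^sub>i\<^sub>,\<^sub>\<mu>\<close> with the value at the right end of the domain (for clamped
  partitions, the last knot) taken as a left limit.
\<close>

definition bspline :: "real list \<Rightarrow> nat \<Rightarrow> nat \<Rightarrow> real \<Rightarrow> real" where
  "bspline \<mu> n i x =
     (if x = last \<mu> then Lim (at_left x) (bspline_rec \<mu> n i) else bspline_rec \<mu> n i x)"

text \<open>
  The partition with end knots \<open>t\<^sub>2\<close> and \<open>t\<^sub>m\<^sub>+\<^sub>1\<close> of multiplicity \<open>e\<close> and interior knots
  \<open>t\<^sub>3, \<dots>, t\<^sub>m\<close> (none if \<open>m = 2\<close>) of multiplicity \<open>s\<close>.
\<close>

definition clamped_knots :: "nat \<Rightarrow> (nat \<Rightarrow> real) \<Rightarrow> nat \<Rightarrow> nat \<Rightarrow> real list" where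
  "clamped_knots m t e s =
     replicate e (t 2) @ concat (map (\<lambda>j. replicate s (t j)) [3..<m + 1]) @ replicate e (t (m + 1))"

definition has_arc_length :: "(real \<Rightarrow> 'a::real_normed_vector) \<Rightarrow> real \<Rightarrow> real \<Rightarrow> real \<Rightarrow> bool" where
  "has_arc_length c a b L \<longleftrightarrow>
     ((\<lambda>x. norm (vector_derivative c (at x within {a..b}))) has_integral L) {a..b}"

end

(*
  On each knot span the quadratic, quartic and quintic splines are rewritten in Bernstein form. With
  w_k = (d_{k+1} z_k + d_k z_{k+1}) / (d_k + d_{k+1}), the spline z has on [t_{k+1}, t_{k+2}] the Bezier
  points w_{k-1}, z_k, w_k; multiplying two quadratics gives the Bezier points of z^2, which are those of
  the quartic spline with coefficients p_k. In Bezier form the derivative of the quintic is a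
  difference of control points, and adjacent pieces visibly agree at the common knot, so the quintic
  spline is an antiderivative of the quartic one on the closed domain. The arc length is the same
  argument applied to z * cnj z, using the symmetrised product of two quadratic splines.
*)
theory Submission
  imports Defs
begin

text \<open>The knot multiplicities come from smoothness. Over simple knots z is C^1, so z^2 is a
  C^1 quartic, which needs multiplicity 4 - 1 = 3. Its antiderivative is a C^2 quintic, of
  multiplicity 5 - 2 = 3 again. The obstacle is that the Cox--de Boor recursion yields values on
  half-open spans, and a limit at the last knot, whereas one-sided derivatives need closed spans.
  Each basis function is therefore replaced by a polynomial per span, and the right end of a span is
  recovered from the next one. This works because the same ratio d_{k+1} / (d_k + d_{k+1})
  determines the last control point before a knot and the first one after it. At the two ends of the
  domain the ratio is 1 and 0, so the curve interpolates its end coefficients there. The product is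
  treated for two coefficient sequences because the speed is |z^2| = z * cnj z.\<close>

text \<open>
  \<open>bspline_piece \<tau> q n i\<close> is the polynomial that agrees with \<open>N\<^sup>n\<^sub>i\<^sub>,\<^sub>\<tau>\<close> on the knot span
  \<open>[\<tau>\<^sub>q, \<tau>\<^sub>q\<^sub>+\<^sub>1)\<close>.
\<close>

fun bspline_piece :: "real list \<Rightarrow> nat \<Rightarrow> nat \<Rightarrow> nat \<Rightarrow> real \<Rightarrow> real" where
  "bspline_piece \<tau> q 0 i x = (if i = q then 1 else 0)"
| "bspline_piece \<tau> q (Suc n) i x =
     (x - \<tau> ! i) / (\<tau> ! (i + Suc n) - \<tau> ! i) * bspline_piece \<tau> q n i x
   + (\<tau> ! (i + Suc n + 1) - x) / (\<tau> ! (i + Suc n + 1) - \<tau> ! (i + 1)) * bspline_piece \<tau> q n (i + 1) x"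

lemma bspline_piece_eq_0: "q < i \<or> i + n < q \<Longrightarrow> bspline_piece \<tau> q n i x = 0"
  by (induction n arbitrary: i) auto

lemma continuous_on_bspline_piece [continuous_intros]: "continuous_on S (bspline_piece \<tau> q n i)"
proof (induction n arbitrary: i)
  case 0
  then show ?case by (simp add: bspline_piece.simps[abs_def])
next
  case (Suc n)
  show ?case
    unfolding bspline_piece.simps[abs_def] divide_inverse by (intro continuous_intros Suc)
qed

text \<open>The two recursions have the same coefficients, so only degree 0 matters. There,
  half-open spans of a sorted list are disjoint and repeated knots give empty ones, so
  \<open>x\<close> determines the position \<open>q\<close>.\<close>

lemma bspline_rec_eq_piece:
  assumes "sorted \<tau>" "Suc q < length \<tau>" "x \<in> {\<tau> ! q..<\<tau> ! Suc q}" "i + n + 1 < length \<tau>"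
  shows "bspline_rec \<tau> n i x = bspline_piece \<tau> q n i x"
  using assms(4)
proof (induction n arbitrary: i)
  case 0
  have "i = q" if x: "x \<in> {\<tau> ! i..<\<tau> ! (i + 1)}"
  proof (rule ccontr)
    assume "i \<noteq> q"
    then consider "i + 1 \<le> q" | "Suc q \<le> i" by linarith
    then show False
    proof cases
      case 1
      then have "\<tau> ! (i + 1) \<le> \<tau> ! q"
        using assms(2) by (intro sorted_nth_mono[OF assms(1)]) auto
      then show False using x assms(3) by auto
    next
      case 2
      then have "\<tau> ! Suc q \<le> \<tau> ! i"
        using 0 by (intro sorted_nth_mono[OF assms(1)]) auto
      then show False using x assms(3) by auto
    qed
  qed
  then have "x \<in> {\<tau> ! i..<\<tau> ! (i + 1)} \<longleftrightarrow> i = q" using assms(3) by auto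
  then show ?case by (simp only: bspline_rec.simps bspline_piece.simps)
next
  case (Suc n)
  have "bspline_rec \<tau> n i x = bspline_piece \<tau> q n i x"
    "bspline_rec \<tau> n (i + 1) x = bspline_piece \<tau> q n (i + 1) x"
    using Suc.prems by (auto intro!: Suc.IH)
  then show ?case by (simp only: bspline_rec.simps bspline_piece.simps)
qed

text \<open>At the last knot the left limit equals the value of the polynomial piece, since the
  piece is continuous and agrees with the recursion just to the left.\<close>

lemma bspline_eq_piece:
  assumes \<tau>: "sorted \<tau>" "Suc q < length \<tau>" "\<tau> ! q < \<tau> ! Suc q"
    and x: "x \<in> {\<tau> ! q..<\<tau> ! Suc q} \<or> x = \<tau> ! Suc q \<and> x = last \<tau>"
    and i: "i + n + 1 < length \<tau>"
  shows "bspline \<tau> n i x = bspline_piece \<tau> q n i x"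
proof (cases "x = last \<tau>")
  case False
  then show ?thesis
    using bspline_rec_eq_piece[OF \<tau>(1,2) _ i] x by (simp add: bspline_def)
next
  case True
  \<comment> \<open>In the half-open case \<open>x\<close> would lie strictly below the last knot,
    so \<open>x\<close> must be the right end of the span.\<close>
  have "\<tau> ! Suc q \<le> \<tau> ! (length \<tau> - 1)"
    using \<tau> by (intro sorted_nth_mono) auto
  moreover have "last \<tau> = \<tau> ! (length \<tau> - 1)"
    using \<tau> by (intro last_conv_nth) auto
  ultimately have xq: "x = \<tau> ! Suc q" using True x by auto
  have "(bspline_piece \<tau> q n i \<longlongrightarrow> bspline_piece \<tau> q n i x) (at_left x)"
    using continuous_on_bspline_piece[of UNIV \<tau> q n i]
    by (simp add: continuous_on_eq_continuous_at isCont_def filterlim_at_split)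
  moreover have "eventually (\<lambda>y. y \<in> {\<tau> ! q..<\<tau> ! Suc q}) (at_left x)"
    unfolding xq eventually_at_left[OF \<tau>(3)] using \<tau>(3) by (intro exI[of _ "\<tau> ! q"]) auto
  then have "eventually (\<lambda>y. bspline_piece \<tau> q n i y = bspline_rec \<tau> n i y) (at_left x)"
    by eventually_elim (simp add: bspline_rec_eq_piece[OF \<tau>(1,2) _ i])
  ultimately have "(bspline_rec \<tau> n i \<longlongrightarrow> bspline_piece \<tau> q n i x) (at_left x)"
    by (rule Lim_transform_eventually)
  then show ?thesis
    using True by (simp add: bspline_def tendsto_Lim)
qed

text \<open>Local support: over the span at position \<open>i + n\<close> only the indices from
  \<open>i\<close> to \<open>i + n\<close> contribute.\<close>

lemma sum_bspline_piece:
  fixes c :: "nat \<Rightarrow> complex"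
  assumes "i + n \<le> N"
  shows "(\<Sum>k = 0..N. c k * of_real (bspline_piece \<tau> (i + n) n k x)) =
    (\<Sum>k = 0..n. c (i + k) * of_real (bspline_piece \<tau> (i + n) n (i + k) x))"
proof -
  have "(\<Sum>k = 0..N. c k * of_real (bspline_piece \<tau> (i + n) n k x)) =
      (\<Sum>k = i..i + n. c k * of_real (bspline_piece \<tau> (i + n) n k x))"
    using assms by (intro sum.mono_neutral_right) (auto simp: bspline_piece_eq_0)
  also have "\<dots> = (\<Sum>k = 0..n. c (i + k) * of_real (bspline_piece \<tau> (i + n) n (i + k) x))"
    using sum.shift_bounds_cl_nat_ivl[of "\<lambda>k. c k * of_real (bspline_piece \<tau> (i + n) n k x)" 0 i n]
    by (simp add: add.commute)
  finally show ?thesis .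
qed

subsection \<open>Bezier form of the pieces\<close>

definition bezier2 :: "complex \<Rightarrow> complex \<Rightarrow> complex \<Rightarrow> real \<Rightarrow> complex" where
  "bezier2 b0 b1 b2 s = (1 - of_real s)^2 * b0 + 2 * of_real s * (1 - of_real s) * b1 + of_real s^2 * b2"

definition bezier4 :: "complex \<Rightarrow> complex \<Rightarrow> complex \<Rightarrow> complex \<Rightarrow> complex \<Rightarrow> real \<Rightarrow> complex" where
  "bezier4 b0 b1 b2 b3 b4 s =
     (1 - of_real s)^4 * b0 + 4 * of_real s * (1 - of_real s)^3 * b1
     + 6 * of_real s^2 * (1 - of_real s)^2 * b2
     + 4 * of_real s^3 * (1 - of_real s) * b3 + of_real s^4 * b4"

definition bezier5 :: "complex \<Rightarrow> complex \<Rightarrow> complex \<Rightarrow> complex \<Rightarrow> complex \<Rightarrow> complex \<Rightarrow> real \<Rightarrow> complex" where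
  "bezier5 b0 b1 b2 b3 b4 b5 s =
     (1 - of_real s)^5 * b0 + 5 * of_real s * (1 - of_real s)^4 * b1
     + 10 * of_real s^2 * (1 - of_real s)^3 * b2 + 10 * of_real s^3 * (1 - of_real s)^2 * b3
     + 5 * of_real s^4 * (1 - of_real s) * b4 + of_real s^5 * b5"

text \<open>The product rule for Bernstein polynomials: the k-th control point is the sum of C(2,i)
  C(2,k-i) / C(4,k) times \<open>u\<close> at i and \<open>v\<close> at k-i. Stated without
  division, so that the premises rewrite the regrouped quartic below.\<close>

lemma bezier2_mult_bezier2:
  assumes "2 * p1 = u0 * v1 + u1 * v0"
    and "6 * p2 = 4 * (u1 * v1) + u0 * v2 + u2 * v0"
    and "2 * p3 = u1 * v2 + u2 * v1"
  shows "bezier2 u0 u1 u2 s * bezier2 v0 v1 v2 s = bezier4 (u0 * v0) p1 p2 p3 (u2 * v2) s"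
proof -
  define \<sigma> where "\<sigma> = complex_of_real s"
  have "bezier4 (u0 * v0) p1 p2 p3 (u2 * v2) s =
      (1 - \<sigma>)^4 * (u0 * v0) + 2 * \<sigma> * (1 - \<sigma>)^3 * (2 * p1) + \<sigma>^2 * (1 - \<sigma>)^2 * (6 * p2)
      + 2 * \<sigma>^3 * (1 - \<sigma>) * (2 * p3) + \<sigma>^4 * (u2 * v2)"
    unfolding bezier4_def \<sigma>_def by (simp add: mult_ac)
  also have "\<dots> = bezier2 u0 u1 u2 s * bezier2 v0 v1 v2 s"
    unfolding assms bezier2_def \<sigma>_def[symmetric] by algebra
  finally show ?thesis by simp
qed

lemma bezier5_has_vector_derivative:
  "(bezier5 b0 b1 b2 b3 b4 b5 has_vector_derivative
     5 * bezier4 (b1 - b0) (b2 - b1) (b3 - b2) (b4 - b3) (b5 - b4) s) (at s within S)"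
proof -
  \<comment> \<open>A polynomial in a complex variable, so that the field derivative rules apply; it
    is restricted to real arguments afterwards.\<close>
  define f :: "complex \<Rightarrow> complex" where "f = (\<lambda>\<sigma>. (1 - \<sigma>)^5 * b0 + 5 * \<sigma> * (1 - \<sigma>)^4 * b1
     + 10 * \<sigma>^2 * (1 - \<sigma>)^3 * b2 + 10 * \<sigma>^3 * (1 - \<sigma>)^2 * b3
     + 5 * \<sigma>^4 * (1 - \<sigma>) * b4 + \<sigma>^5 * b5)"
  have "(f has_field_derivative
      5 * bezier4 (b1 - b0) (b2 - b1) (b3 - b2) (b4 - b3) (b5 - b4) s) (at (of_real s))"
    unfolding f_def bezier4_def
    by (rule derivative_eq_intros refl)+ (simp, algebra)
  then have "((\<lambda>x. f (of_real x)) has_vector_derivative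
      5 * bezier4 (b1 - b0) (b2 - b1) (b3 - b2) (b4 - b3) (b5 - b4) s) (at s within S)"
    by (rule has_vector_derivative_real_field)
  then show ?thesis
    by (simp add: f_def bezier5_def[abs_def])
qed

text \<open>
  A span \<open>[a, b]\<close> with neighbouring knots \<open>a0\<close> and \<open>b0\<close>: these six quotients are the only ones that
  the Cox--de Boor recursion meets, so in terms of \<open>\<alpha>\<close>, \<open>\<gamma>\<close> and \<open>s\<close> every piece is a polynomial.
\<close>

lemma knot_ratios:
  fixes a0 a b b0 x :: real
  assumes ord: "a0 \<le> a" "a < b" "b \<le> b0"
    and \<alpha>: "\<alpha> = (b - a) / (b - a0)" and \<gamma>: "\<gamma> = (b0 - b) / (b0 - a)"
    and s: "s = (x - a) / (b - a)"
  shows "(x - a) / (b - a) = s" "(b - x) / (b - a) = 1 - s"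
    "(x - a0) / (b - a0) = 1 - \<alpha> * (1 - s)" "(b - x) / (b - a0) = \<alpha> * (1 - s)"
    "(x - a) / (b0 - a) = (1 - \<gamma>) * s" "(b0 - x) / (b0 - a) = 1 - (1 - \<gamma>) * s"
proof -
  have nz: "b - a \<noteq> 0" "b - a0 \<noteq> 0" "b0 - a \<noteq> 0" using ord by auto
  show "(x - a) / (b - a) = s" by (simp add: s)
  show 1: "(b - x) / (b - a) = 1 - s"
    unfolding s using nz(1) by (simp add: divide_simps)
  show 2: "(b - x) / (b - a0) = \<alpha> * (1 - s)"
    unfolding 1[symmetric] \<alpha> using nz by simp
  show "(x - a0) / (b - a0) = 1 - \<alpha> * (1 - s)"
    unfolding 2[symmetric] using nz(2) by (simp add: divide_simps)
  have "1 - \<gamma> = (b - a) / (b0 - a)"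
    unfolding \<gamma> using nz(3) by (simp add: divide_simps)
  then show 3: "(x - a) / (b0 - a) = (1 - \<gamma>) * s"
    using nz by (simp add: s)
  show "(b0 - x) / (b0 - a) = 1 - (1 - \<gamma>) * s"
    unfolding 3[symmetric] using nz(3) by (simp add: divide_simps)
qed

text \<open>Bezier points arise by knot insertion until \<open>a\<close> and \<open>b\<close> have
  multiplicity equal to the degree. Simple knots of a quadratic need one insertion each, hence one
  average at either end. The outermost knots of the supports occur only next to pieces that vanish
  on this span.\<close>

lemma sum_bspline_piece_bezier2:
  fixes c :: "nat \<Rightarrow> complex"
  assumes \<tau>: "\<tau> ! (i + 1) = a0" "\<tau> ! (i + 2) = a" "\<tau> ! (i + 3) = b" "\<tau> ! (i + 4) = b0"
    and rs: "a0 \<le> a" "a < b" "b \<le> b0"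
      "\<alpha> = (b - a) / (b - a0)" "\<gamma> = (b0 - b) / (b0 - a)" "s = (x - a) / (b - a)"
  shows "(\<Sum>k = 0..2. c (i + k) * of_real (bspline_piece \<tau> (i + 2) 2 (i + k) x)) =
    bezier2 (of_real \<alpha> * c i + (1 - of_real \<alpha>) * c (i + 1)) (c (i + 1))
      (of_real \<gamma> * c (i + 1) + (1 - of_real \<gamma>) * c (i + 2)) s"
proof -
  note r = knot_ratios[OF rs]
  have \<tau>': "\<tau> ! Suc i = a0" "\<tau> ! Suc (Suc i) = a" "\<tau> ! Suc (Suc (Suc i)) = b"
    "\<tau> ! Suc (Suc (Suc (Suc i))) = b0"
    using \<tau> by (simp_all add: eval_nat_numeral)
  show ?thesis
    \<comment> \<open>The division rules are removed so that the quotients keep the shape that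
      \<open>knot_ratios\<close> rewrites.\<close>
    by (simp add: numeral_2_eq_2 \<tau>' r bezier2_def del: times_divide_eq_left times_divide_eq_right times_divide_times_eq of_real_divide) algebra
qed

section \<open>Quartic and quintic pieces in the Bernstein basis\<close>

lemma choose4: "(4::nat) choose 1 = 4" "(4::nat) choose 2 = 6" "(4::nat) choose 3 = 4"
  by code_simp+

lemma choose5: "(5::nat) choose 1 = 5" "(5::nat) choose 2 = 10" "(5::nat) choose 3 = 10" "(5::nat) choose 4 = 5"
  by code_simp+

lemma bezier4_Bernstein:
  "bezier4 b0 b1 b2 b3 b4 s = of_real (Bernstein 4 0 s) * b0 + of_real (Bernstein 4 1 s) * b1
     + of_real (Bernstein 4 2 s) * b2 + of_real (Bernstein 4 3 s) * b3 + of_real (Bernstein 4 4 s) * b4"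
  unfolding bezier4_def Bernstein_def choose4 by simp

lemma bezier5_Bernstein:
  "bezier5 b0 b1 b2 b3 b4 b5 s = of_real (Bernstein 5 0 s) * b0 + of_real (Bernstein 5 1 s) * b1
     + of_real (Bernstein 5 2 s) * b2 + of_real (Bernstein 5 3 s) * b3 + of_real (Bernstein 5 4 s) * b4
     + of_real (Bernstein 5 5 s) * b5"
  unfolding bezier5_def Bernstein_def choose5 by simp

text \<open>Turns degrees and positions into iterated successors, the form in which the recursion
  unfolds and in which the knot hypotheses must then be stated.\<close>

lemma nat_numerals_Suc:
  "(1::nat) = Suc 0" "(2::nat) = Suc 1" "(3::nat) = Suc 2" "(4::nat) = Suc 3" "(5::nat) = Suc 4"
  "(6::nat) = Suc 5" "(7::nat) = Suc 6" "(8::nat) = Suc 7" "(9::nat) = Suc 8" "(10::nat) = Suc 9"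
  by simp_all

text \<open>Read by columns, these are the weights with which the coefficients enter each Bezier
  point. Only the two end points are averages, because a triple knot of a quartic lacks a single
  insertion.\<close>

lemma bspline_piece_4:
  assumes \<tau>: "\<tau> ! (i + 1) = a0" "\<tau> ! (i + 2) = a" "\<tau> ! (i + 3) = a" "\<tau> ! (i + 4) = a"
      "\<tau> ! (i + 5) = b" "\<tau> ! (i + 6) = b" "\<tau> ! (i + 7) = b" "\<tau> ! (i + 8) = b0"
    and rs: "a0 \<le> a" "a < b" "b \<le> b0"
      "\<alpha> = (b - a) / (b - a0)" "\<gamma> = (b0 - b) / (b0 - a)" "s = (x - a) / (b - a)"
  shows "bspline_piece \<tau> (i + 4) 4 i x = \<alpha> * Bernstein 4 0 s"
    "bspline_piece \<tau> (i + 4) 4 (i + 1) x = (1 - \<alpha>) * Bernstein 4 0 s + Bernstein 4 1 s"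
    "bspline_piece \<tau> (i + 4) 4 (i + 2) x = Bernstein 4 2 s"
    "bspline_piece \<tau> (i + 4) 4 (i + 3) x = Bernstein 4 3 s + \<gamma> * Bernstein 4 4 s"
    "bspline_piece \<tau> (i + 4) 4 (i + 4) x = (1 - \<gamma>) * Bernstein 4 4 s"
proof -
  note r = knot_ratios[OF rs]
  note \<tau>' = \<tau>[unfolded nat_numerals_Suc add_Suc_right add_0_right]
  show "bspline_piece \<tau> (i + 4) 4 i x = \<alpha> * Bernstein 4 0 s"
    unfolding Bernstein_def choose4 binomial_n_0 binomial_n_n
    unfolding nat_numerals_Suc add_Suc_right add_0_right
    by (simp add: \<tau>' r del: times_divide_eq_left times_divide_eq_right times_divide_times_eq)
  show "bspline_piece \<tau> (i + 4) 4 (i + 1) x = (1 - \<alpha>) * Bernstein 4 0 s + Bernstein 4 1 s"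
    unfolding Bernstein_def choose4 binomial_n_0 binomial_n_n
    unfolding nat_numerals_Suc add_Suc_right add_0_right
    by (simp add: \<tau>' r del: times_divide_eq_left times_divide_eq_right times_divide_times_eq) algebra
  show "bspline_piece \<tau> (i + 4) 4 (i + 2) x = Bernstein 4 2 s"
    unfolding Bernstein_def choose4 binomial_n_0 binomial_n_n
    unfolding nat_numerals_Suc add_Suc_right add_0_right
    by (simp add: \<tau>' r del: times_divide_eq_left times_divide_eq_right times_divide_times_eq)
  show "bspline_piece \<tau> (i + 4) 4 (i + 3) x = Bernstein 4 3 s + \<gamma> * Bernstein 4 4 s"
    unfolding Bernstein_def choose4 binomial_n_0 binomial_n_n
    unfolding nat_numerals_Suc add_Suc_right add_0_right
    by (simp add: \<tau>' r del: times_divide_eq_left times_divide_eq_right times_divide_times_eq) algebra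
  show "bspline_piece \<tau> (i + 4) 4 (i + 4) x = (1 - \<gamma>) * Bernstein 4 4 s"
    unfolding Bernstein_def choose4 binomial_n_0 binomial_n_n
    unfolding nat_numerals_Suc add_Suc_right add_0_right
    by (simp add: \<tau>' r del: times_divide_eq_left times_divide_eq_right times_divide_times_eq)
qed

text \<open>A triple knot of a quintic lacks two insertions, so the weights at an end are those of
  two successive averages: \<open>\<alpha>^2\<close>, \<open>2 * \<alpha> * (1 - \<alpha>)\<close>
  and \<open>(1 - \<alpha>)^2\<close>.\<close>

lemma bspline_piece_5:
  assumes \<tau>: "\<tau> ! (i + 1) = a0" "\<tau> ! (i + 2) = a0" "\<tau> ! (i + 3) = a" "\<tau> ! (i + 4) = a"
      "\<tau> ! (i + 5) = a" "\<tau> ! (i + 6) = b" "\<tau> ! (i + 7) = b" "\<tau> ! (i + 8) = b"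
      "\<tau> ! (i + 9) = b0" "\<tau> ! (i + 10) = b0"
    and rs: "a0 \<le> a" "a < b" "b \<le> b0"
      "\<alpha> = (b - a) / (b - a0)" "\<gamma> = (b0 - b) / (b0 - a)" "s = (x - a) / (b - a)"
  shows "bspline_piece \<tau> (i + 5) 5 i x = \<alpha>^2 * Bernstein 5 0 s"
    "bspline_piece \<tau> (i + 5) 5 (i + 1) x = 2 * \<alpha> * (1 - \<alpha>) * Bernstein 5 0 s + \<alpha> * Bernstein 5 1 s"
    "bspline_piece \<tau> (i + 5) 5 (i + 2) x = (1 - \<alpha>)^2 * Bernstein 5 0 s + (1 - \<alpha>) * Bernstein 5 1 s + Bernstein 5 2 s"
    "bspline_piece \<tau> (i + 5) 5 (i + 3) x = Bernstein 5 3 s + \<gamma> * Bernstein 5 4 s + \<gamma>^2 * Bernstein 5 5 s"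
    "bspline_piece \<tau> (i + 5) 5 (i + 4) x = (1 - \<gamma>) * Bernstein 5 4 s + 2 * \<gamma> * (1 - \<gamma>) * Bernstein 5 5 s"
    "bspline_piece \<tau> (i + 5) 5 (i + 5) x = (1 - \<gamma>)^2 * Bernstein 5 5 s"
proof -
  note r = knot_ratios[OF rs]
  note \<tau>' = \<tau>[unfolded nat_numerals_Suc add_Suc_right add_0_right]
  show "bspline_piece \<tau> (i + 5) 5 i x = \<alpha>^2 * Bernstein 5 0 s"
    unfolding Bernstein_def choose5 binomial_n_0 binomial_n_n
    unfolding nat_numerals_Suc add_Suc_right add_0_right
    by (simp add: \<tau>' r del: times_divide_eq_left times_divide_eq_right times_divide_times_eq)
  show "bspline_piece \<tau> (i + 5) 5 (i + 1) x = 2 * \<alpha> * (1 - \<alpha>) * Bernstein 5 0 s + \<alpha> * Bernstein 5 1 s"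
    unfolding Bernstein_def choose5 binomial_n_0 binomial_n_n
    unfolding nat_numerals_Suc add_Suc_right add_0_right
    by (simp add: \<tau>' r del: times_divide_eq_left times_divide_eq_right times_divide_times_eq) algebra
  show "bspline_piece \<tau> (i + 5) 5 (i + 2) x = (1 - \<alpha>)^2 * Bernstein 5 0 s + (1 - \<alpha>) * Bernstein 5 1 s + Bernstein 5 2 s"
    unfolding Bernstein_def choose5 binomial_n_0 binomial_n_n
    unfolding nat_numerals_Suc add_Suc_right add_0_right
    by (simp add: \<tau>' r del: times_divide_eq_left times_divide_eq_right times_divide_times_eq) algebra
  show "bspline_piece \<tau> (i + 5) 5 (i + 3) x = Bernstein 5 3 s + \<gamma> * Bernstein 5 4 s + \<gamma>^2 * Bernstein 5 5 s"
    unfolding Bernstein_def choose5 binomial_n_0 binomial_n_n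
    unfolding nat_numerals_Suc add_Suc_right add_0_right
    by (simp add: \<tau>' r del: times_divide_eq_left times_divide_eq_right times_divide_times_eq) algebra
  show "bspline_piece \<tau> (i + 5) 5 (i + 4) x = (1 - \<gamma>) * Bernstein 5 4 s + 2 * \<gamma> * (1 - \<gamma>) * Bernstein 5 5 s"
    unfolding Bernstein_def choose5 binomial_n_0 binomial_n_n
    unfolding nat_numerals_Suc add_Suc_right add_0_right
    by (simp add: \<tau>' r del: times_divide_eq_left times_divide_eq_right times_divide_times_eq) algebra
  show "bspline_piece \<tau> (i + 5) 5 (i + 5) x = (1 - \<gamma>)^2 * Bernstein 5 5 s"
    unfolding Bernstein_def choose5 binomial_n_0 binomial_n_n
    unfolding nat_numerals_Suc add_Suc_right add_0_right
    by (simp add: \<tau>' r del: times_divide_eq_left times_divide_eq_right times_divide_times_eq)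
qed

lemma sum_bspline_piece_bezier4:
  fixes c :: "nat \<Rightarrow> complex"
  assumes \<tau>: "\<tau> ! (i + 1) = a0" "\<tau> ! (i + 2) = a" "\<tau> ! (i + 3) = a" "\<tau> ! (i + 4) = a"
      "\<tau> ! (i + 5) = b" "\<tau> ! (i + 6) = b" "\<tau> ! (i + 7) = b" "\<tau> ! (i + 8) = b0"
    and rs: "a0 \<le> a" "a < b" "b \<le> b0"
      "\<alpha> = (b - a) / (b - a0)" "\<gamma> = (b0 - b) / (b0 - a)" "s = (x - a) / (b - a)"
  shows "(\<Sum>k = 0..4. c (i + k) * of_real (bspline_piece \<tau> (i + 4) 4 (i + k) x)) =
    bezier4 (of_real \<alpha> * c i + (1 - of_real \<alpha>) * c (i + 1)) (c (i + 1)) (c (i + 2)) (c (i + 3))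
      (of_real \<gamma> * c (i + 3) + (1 - of_real \<gamma>) * c (i + 4)) s"
proof -
  have sum: "(\<Sum>k = 0..4. f k) = f 0 + f 1 + f 2 + f 3 + f 4" for f :: "nat \<Rightarrow> complex"
    by (simp add: nat_numerals_Suc)
  show ?thesis
    unfolding sum add_0_right bspline_piece_4[OF \<tau> rs] bezier4_Bernstein
    by (simp add: algebra_simps power2_eq_square)
qed

lemma sum_bspline_piece_bezier5:
  fixes c :: "nat \<Rightarrow> complex"
  assumes \<tau>: "\<tau> ! (i + 1) = a0" "\<tau> ! (i + 2) = a0" "\<tau> ! (i + 3) = a" "\<tau> ! (i + 4) = a"
      "\<tau> ! (i + 5) = a" "\<tau> ! (i + 6) = b" "\<tau> ! (i + 7) = b" "\<tau> ! (i + 8) = b"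
      "\<tau> ! (i + 9) = b0" "\<tau> ! (i + 10) = b0"
    and rs: "a0 \<le> a" "a < b" "b \<le> b0"
      "\<alpha> = (b - a) / (b - a0)" "\<gamma> = (b0 - b) / (b0 - a)" "s = (x - a) / (b - a)"
  shows "(\<Sum>k = 0..5. c (i + k) * of_real (bspline_piece \<tau> (i + 5) 5 (i + k) x)) =
    bezier5
      (of_real \<alpha> * (of_real \<alpha> * c i + (1 - of_real \<alpha>) * c (i + 1))
        + (1 - of_real \<alpha>) * (of_real \<alpha> * c (i + 1) + (1 - of_real \<alpha>) * c (i + 2)))
      (of_real \<alpha> * c (i + 1) + (1 - of_real \<alpha>) * c (i + 2)) (c (i + 2)) (c (i + 3))
      (of_real \<gamma> * c (i + 3) + (1 - of_real \<gamma>) * c (i + 4))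
      (of_real \<gamma> * (of_real \<gamma> * c (i + 3) + (1 - of_real \<gamma>) * c (i + 4))
        + (1 - of_real \<gamma>) * (of_real \<gamma> * c (i + 4) + (1 - of_real \<gamma>) * c (i + 5))) s"
proof -
  have sum: "(\<Sum>k = 0..5. f k) = f 0 + f 1 + f 2 + f 3 + f 4 + f 5" for f :: "nat \<Rightarrow> complex"
    by (simp add: nat_numerals_Suc)
  show ?thesis
    unfolding sum add_0_right bspline_piece_5[OF \<tau> rs] bezier5_Bernstein
    by (simp add: algebra_simps power2_eq_square)
qed

subsection \<open>Clamped partitions\<close>

lemma nth_concat_replicate:
  "q < s * n \<Longrightarrow> concat (map (\<lambda>j. replicate s (f j)) [a..<a + n]) ! q = f (a + q div s)"
proof (induction n)
  case (Suc n)
  have len: "length (concat (map (\<lambda>j. replicate s (f j)) [a..<a + n])) = s * n"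
    by (induction n) auto
  show ?case
  proof (cases "q < s * n")
    case True
    then show ?thesis using Suc len by (simp add: nth_append)
  next
    case False
    then have "q div s = n"
      using Suc.prems by (intro div_nat_eqI) (auto simp: mult.commute)
    then show ?thesis using False Suc.prems len by (simp add: nth_append)
  qed
qed simp

locale clamped_partition =
  fixes m :: nat and t d :: "nat \<Rightarrow> real"
  assumes m: "m \<ge> 2"
    and t: "strict_mono_on {2..m + 1} t"
    and d: "\<And>k. k \<in> {1..m - 1} \<Longrightarrow> d k = t (k + 2) - t (k + 1)" "d 0 = 0" "d m = 0"
begin

text \<open>Indices are clamped because \<open>t\<close> is unconstrained outside \<open>{2..m + 1}\<close>.\<close>

definition knot :: "nat \<Rightarrow> real" where
  "knot j = t (max 2 (min (m + 1) j))"

lemma knot_eq: "2 \<le> j \<Longrightarrow> j \<le> m + 1 \<Longrightarrow> knot j = t j"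
  by (simp add: knot_def max_def min_def)

lemma knot_eq_t2: "j \<le> 2 \<Longrightarrow> knot j = t 2"
  using m by (simp add: knot_def max_def min_def)

lemma t_mono: "2 \<le> i \<Longrightarrow> i \<le> j \<Longrightarrow> j \<le> m + 1 \<Longrightarrow> t i \<le> t j"
  using strict_mono_on_leD[OF t] by auto

lemma t_less: "2 \<le> i \<Longrightarrow> i < j \<Longrightarrow> j \<le> m + 1 \<Longrightarrow> t i < t j"
  using strict_mono_onD[OF t] by auto

lemma knot_mono: "i \<le> j \<Longrightarrow> knot i \<le> knot j"
  unfolding knot_def using m by (intro t_mono) auto

text \<open>Clamping the indices turns the conventions d_0 = d_m = 0 into ordinary knot
  differences.\<close>

lemma d_eq_knot: "k \<le> m \<Longrightarrow> d k = knot (k + 2) - knot (k + 1)"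
proof -
  assume "k \<le> m"
  then consider "k = 0" | "k = m" | "k \<in> {1..m - 1}" by force
  then show ?thesis using d by cases (auto simp: knot_def knot_eq)
qed

lemma d_nonneg: "k \<le> m \<Longrightarrow> 0 \<le> d k"
  by (simp add: d_eq_knot knot_mono)

lemma d_pos: "j < m - 1 \<Longrightarrow> 0 < d (Suc j)"
  using t_less[of "j + 2" "j + 3"] d(1)[of "Suc j"] by (simp add: eval_nat_numeral)

lemma length_clamped_knots: "length (clamped_knots m t e s) = 2 * e + s * (m - 2)"
proof -
  have "length (concat (map (\<lambda>j. replicate s (t j)) [a..<b])) = s * (b - a)" for a b
    by (induction b) (auto simp: Suc_diff_le)
  from this[of 3 "m + 1"] show ?thesis by (simp add: clamped_knots_def)
qed

text \<open>The index of the knot grows by one every \<open>s\<close> positions and is 3 at position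
  \<open>r + s\<close>, where the first block ends. In the end blocks the quotient may leave the
  range from 2 to m + 1, which \<open>knot\<close> absorbs; \<open>r \<le> 2 * s\<close> keeps the
  subtraction from truncating.\<close>

lemma nth_clamped_knots:
  assumes q: "q < 2 * (r + s) + s * (m - 2)" and s: "s > 0" "r \<le> 2 * s"
  shows "clamped_knots m t (r + s) s ! q = knot ((q + 2 * s - r) div s)"
proof -
  let ?M = "concat (map (\<lambda>j. replicate s (t j)) [3..<m + 1])"
  have M: "[3..<m + 1] = [3..<3 + (m - 2)]" using m by simp
  have len: "length ?M = s * (m - 2)"
    using length_clamped_knots[of 0 s] by (simp add: clamped_knots_def)
  consider "q < r + s" | "r + s \<le> q" "q < r + s + s * (m - 2)" | "r + s + s * (m - 2) \<le> q"
    by linarith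
  then show ?thesis
  proof cases
    case 1
    then have "(q + 2 * s - r) div s < 3"
      using s by (intro less_mult_imp_div_less) auto
    then show ?thesis
      using 1 by (simp add: clamped_knots_def nth_append knot_eq_t2)
  next
    case 2
    have "(q + 2 * s - r) div s = ((q - (r + s)) + 3 * s) div s"
      using 2 s by (simp add: algebra_simps)
    also have "\<dots> = 3 + (q - (r + s)) div s"
      using s by simp
    finally have e: "(q + 2 * s - r) div s = 3 + (q - (r + s)) div s" .
    have lt: "q - (r + s) < s * (m - 2)" using 2 by linarith
    then have "(q - (r + s)) div s < m - 2"
      using s by (intro less_mult_imp_div_less) (auto simp: mult.commute)
    moreover have "?M ! (q - (r + s)) = t (3 + (q - (r + s)) div s)"
      unfolding M using lt by (rule nth_concat_replicate)
    ultimately have "?M ! (q - (r + s)) = knot ((q + 2 * s - r) div s)"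
      unfolding e by (subst knot_eq) linarith+
    moreover have "clamped_knots m t (r + s) s ! q = ?M ! (q - (r + s))"
      using 2 lt len unfolding clamped_knots_def
      by (simp only: nth_append length_append length_replicate) (simp add: not_less)
    ultimately show ?thesis by (rule trans[rotated])
  next
    case 3
    have "m + 1 \<le> (q + 2 * s - r) div s"
    proof -
      have "(m + 1) * s = s * (m - 2) + 3 * s"
        using m by (auto simp: algebra_simps dest!: le_Suc_ex)
      then have "(m + 1) * s \<le> q + 2 * s - r" using 3 s by linarith
      then show ?thesis using s by (simp add: less_eq_div_iff_mult_less_eq)
    qed
    then have kn: "knot ((q + 2 * s - r) div s) = t (m + 1)"
      using m by (simp add: knot_def)
    have "\<not> q < r + s" "\<not> q - (r + s) < s * (m - 2)"
      using 3 by linarith+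
    moreover have "q - (r + s) - s * (m - 2) < r + s"
      using 3 q by (simp add: less_diff_conv2)
    ultimately have "clamped_knots m t (r + s) s ! q = t (m + 1)"
      using len unfolding clamped_knots_def
      by (simp only: nth_append length_append length_replicate if_False nth_replicate)
    then show ?thesis unfolding kn .
  qed
qed

lemma sorted_clamped_knots:
  assumes "s > 0" "r \<le> 2 * s"
  shows "sorted (clamped_knots m t (r + s) s)"
  unfolding sorted_iff_nth_mono length_clamped_knots
proof (intro allI impI)
  fix i j assume "i \<le> j" "j < 2 * (r + s) + s * (m - 2)"
  moreover from this have "i < 2 * (r + s) + s * (m - 2)" by linarith
  ultimately show "clamped_knots m t (r + s) s ! i \<le> clamped_knots m t (r + s) s ! j"
    using assms by (simp only: nth_clamped_knots) (intro knot_mono div_le_mono, linarith)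
qed

lemma last_clamped_knots: "s > 0 \<Longrightarrow> last (clamped_knots m t (r + s) s) = t (m + 1)"
  by (simp add: clamped_knots_def)

section \<open>Splines restricted to one segment\<close>

text \<open>Half-open, except that the last segment contains the right end of the domain.\<close>

definition segment :: "nat \<Rightarrow> real set" where
  "segment j = {x \<in> {t (j + 2)..t (j + 3)}. x = t (j + 3) \<longrightarrow> j + 2 = m}"

text \<open>The conditions on \<open>q\<close> say that it is the position of the last copy of
  \<open>t (j + 2)\<close>. For degrees 2, 4 and 5 this will be \<open>j + 2\<close>,
  \<open>3 * j + 4\<close> and \<open>3 * j + 5\<close>.\<close>

lemma bspline_clamped_eq_piece:
  assumes s: "s > 0" "r \<le> 2 * s" and j: "j < m - 1" and x: "x \<in> segment j"
    and q: "(q + 2 * s - r) div s = j + 2" "(Suc q + 2 * s - r) div s = j + 3"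
      "Suc q < 2 * (r + s) + s * (m - 2)"
    and i: "i + n + 1 < 2 * (r + s) + s * (m - 2)"
  shows "bspline (clamped_knots m t (r + s) s) n i x = bspline_piece (clamped_knots m t (r + s) s) q n i x"
proof (rule bspline_eq_piece)
  have "q < 2 * (r + s) + s * (m - 2)" using q(3) by linarith
  from nth_clamped_knots[OF this s] nth_clamped_knots[OF q(3) s] j
  have k: "clamped_knots m t (r + s) s ! q = t (j + 2)" "clamped_knots m t (r + s) s ! Suc q = t (j + 3)"
    unfolding q(1,2) by (simp_all add: knot_eq)
  show "clamped_knots m t (r + s) s ! q < clamped_knots m t (r + s) s ! Suc q"
    unfolding k using j by (intro t_less) auto
  show "x \<in> {clamped_knots m t (r + s) s ! q..<clamped_knots m t (r + s) s ! Suc q} \<or>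
    x = clamped_knots m t (r + s) s ! Suc q \<and> x = last (clamped_knots m t (r + s) s)"
  proof (cases "x = t (j + 3)")
    case True
    then have "j + 3 = m + 1" using x by (simp add: segment_def)
    then show ?thesis unfolding k last_clamped_knots[OF s(1)] True by (simp only:) simp
  next
    case False
    then show ?thesis unfolding k using x by (simp add: segment_def)
  qed
  show "sorted (clamped_knots m t (r + s) s)" using s by (rule sorted_clamped_knots)
  show "Suc q < length (clamped_knots m t (r + s) s)" using q(3) by (simp only: length_clamped_knots)
  show "i + n + 1 < length (clamped_knots m t (r + s) s)" using i by (simp only: length_clamped_knots)
qed

text \<open>One number with two roles: it is \<open>\<alpha>\<close> for segment \<open>j\<close>
  and \<open>\<gamma>\<close> for the segment before it, which is why adjacent pieces meet.\<close>

definition ratio :: "nat \<Rightarrow> real" where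
  "ratio j = d (Suc j) / (d j + d (Suc j))"

text \<open>
  \<open>mix k (z k) (z (k + 1))\<close> is \<open>(d\<^sub>k\<^sub>+\<^sub>1 z\<^sub>k + d\<^sub>k z\<^sub>k\<^sub>+\<^sub>1) / (d\<^sub>k + d\<^sub>k\<^sub>+\<^sub>1)\<close>, the value of the quadratic spline at
  the knot \<open>t\<^sub>k\<^sub>+\<^sub>2\<close>.
\<close>

definition mix :: "nat \<Rightarrow> complex \<Rightarrow> complex \<Rightarrow> complex" where
  "mix j u v = of_real (ratio j) * u + (1 - of_real (ratio j)) * v"

definition param :: "nat \<Rightarrow> real \<Rightarrow> real" where
  "param j x = (x - t (j + 2)) / d (Suc j)"

lemma d_eq_knots:
  assumes "j < m - 1"
  shows "d j = knot (j + 2) - knot (j + 1)" "d (Suc j) = knot (j + 3) - knot (j + 2)"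
    "d (Suc (Suc j)) = knot (j + 4) - knot (j + 3)"
  using assms d_eq_knot[of j] d_eq_knot[of "j + 1"] d_eq_knot[of "j + 2"]
  by (simp_all add: numeral_eq_Suc)

text \<open>Supplies, in this order, the premises \<open>rs\<close> of the lemmas that convert
  pieces to Bezier form.\<close>

lemma segment_knots:
  assumes j: "j < m - 1"
  shows "knot (j + 1) \<le> knot (j + 2)" "knot (j + 2) < knot (j + 3)" "knot (j + 3) \<le> knot (j + 4)"
    "ratio j = (knot (j + 3) - knot (j + 2)) / (knot (j + 3) - knot (j + 1))"
    "ratio (Suc j) = (knot (j + 4) - knot (j + 3)) / (knot (j + 4) - knot (j + 2))"
    "param j x = (x - knot (j + 2)) / (knot (j + 3) - knot (j + 2))"
proof -
  show "knot (j + 2) < knot (j + 3)"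
    using j by (simp add: knot_eq t_less)
  show "knot (j + 1) \<le> knot (j + 2)" "knot (j + 3) \<le> knot (j + 4)"
    by (simp_all add: knot_mono)
  show "ratio j = (knot (j + 3) - knot (j + 2)) / (knot (j + 3) - knot (j + 1))"
    "ratio (Suc j) = (knot (j + 4) - knot (j + 3)) / (knot (j + 4) - knot (j + 2))"
    unfolding ratio_def d_eq_knots[OF j] by simp_all
  have "t (j + 2) = knot (j + 2)" using j by (simp add: knot_eq)
  then show "param j x = (x - knot (j + 2)) / (knot (j + 3) - knot (j + 2))"
    unfolding param_def d_eq_knots[OF j] by simp
qed

lemma spline2_segment:
  assumes j: "j < m - 1" and x: "x \<in> segment j"
  shows "(\<Sum>i = 0..m. c i * of_real (bspline (clamped_knots m t 3 1) 2 i x)) =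
    bezier2 (mix j (c j) (c (j + 1))) (c (j + 1)) (mix (Suc j) (c (j + 1)) (c (j + 2))) (param j x)"
proof -
  let ?K = "clamped_knots m t 3 1"
  have nth: "?K ! q = knot q" if "q < m + 4" for q
    using nth_clamped_knots[of q 2 1] m that by simp
  have "(\<Sum>i = 0..m. c i * of_real (bspline ?K 2 i x)) = (\<Sum>i = 0..m. c i * of_real (bspline_piece ?K (j + 2) 2 i x))"
    using bspline_clamped_eq_piece[of 1 2 j x "j + 2" _ 2] j x m by (intro sum.cong) auto
  also have "\<dots> = (\<Sum>k = 0..2. c (j + k) * of_real (bspline_piece ?K (j + 2) 2 (j + k) x))"
    using j by (intro sum_bspline_piece) auto
  also have "\<dots> = bezier2 (mix j (c j) (c (j + 1))) (c (j + 1)) (mix (Suc j) (c (j + 1)) (c (j + 2))) (param j x)"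
    unfolding mix_def
    by (rule sum_bspline_piece_bezier2[OF _ _ _ _ segment_knots[OF j]])
      (rule nth, use j in linarith)+
  finally show ?thesis .
qed

lemma spline4_segment:
  assumes j: "j < m - 1" and x: "x \<in> segment j"
  shows "(\<Sum>i = 0..3 * m - 2. c i * of_real (bspline (clamped_knots m t 5 3) 4 i x)) =
    bezier4 (mix j (c (3 * j)) (c (3 * j + 1))) (c (3 * j + 1)) (c (3 * j + 2)) (c (3 * j + 3))
      (mix (Suc j) (c (3 * j + 3)) (c (3 * j + 4))) (param j x)"
proof -
  let ?K = "clamped_knots m t 5 3"
  have nth: "?K ! q = knot ((q + 4) div 3)" if "q < 3 * m + 4" for q
    using nth_clamped_knots[of q 2 3] m that by (simp add: add.commute)
  have "(\<Sum>i = 0..3 * m - 2. c i * of_real (bspline ?K 4 i x)) =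
      (\<Sum>i = 0..3 * m - 2. c i * of_real (bspline_piece ?K (3 * j + 4) 4 i x))"
    using bspline_clamped_eq_piece[of 3 2 j x "3 * j + 4" _ 4] j x m by (intro sum.cong) auto
  also have "\<dots> = (\<Sum>k = 0..4. c (3 * j + k) * of_real (bspline_piece ?K (3 * j + 4) 4 (3 * j + k) x))"
    using j by (intro sum_bspline_piece) auto
  also have "\<dots> = bezier4 (mix j (c (3 * j)) (c (3 * j + 1))) (c (3 * j + 1)) (c (3 * j + 2)) (c (3 * j + 3))
      (mix (Suc j) (c (3 * j + 3)) (c (3 * j + 4))) (param j x)"
    unfolding mix_def
    by (rule sum_bspline_piece_bezier4[OF _ _ _ _ _ _ _ _ segment_knots[OF j]])
      (subst nth, use j in linarith, rule arg_cong[where f = knot], presburger)+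
  finally show ?thesis .
qed

lemma spline5_segment:
  assumes j: "j < m - 1" and x: "x \<in> segment j"
  shows "(\<Sum>i = 0..3 * m - 1. c i * of_real (bspline (clamped_knots m t 6 3) 5 i x)) =
    bezier5 (mix j (mix j (c (3 * j)) (c (3 * j + 1))) (mix j (c (3 * j + 1)) (c (3 * j + 2))))
      (mix j (c (3 * j + 1)) (c (3 * j + 2))) (c (3 * j + 2)) (c (3 * j + 3))
      (mix (Suc j) (c (3 * j + 3)) (c (3 * j + 4)))
      (mix (Suc j) (mix (Suc j) (c (3 * j + 3)) (c (3 * j + 4))) (mix (Suc j) (c (3 * j + 4)) (c (3 * j + 5))))
      (param j x)"
    (is "_ = ?B")
proof -
  let ?K = "clamped_knots m t 6 3"
  have nth: "?K ! q = knot ((q + 3) div 3)" if "q < 3 * m + 6" for q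
    using nth_clamped_knots[of q 3 3] m that by (simp add: add.commute)
  have "(\<Sum>i = 0..3 * m - 1. c i * of_real (bspline ?K 5 i x)) =
      (\<Sum>i = 0..3 * m - 1. c i * of_real (bspline_piece ?K (3 * j + 5) 5 i x))"
    using bspline_clamped_eq_piece[of 3 3 j x "3 * j + 5" _ 5] j x m by (intro sum.cong) auto
  also have "\<dots> = (\<Sum>k = 0..5. c (3 * j + k) * of_real (bspline_piece ?K (3 * j + 5) 5 (3 * j + k) x))"
    using j by (intro sum_bspline_piece) auto
  also have "\<dots> = ?B"
    unfolding mix_def
    by (rule sum_bspline_piece_bezier5[OF _ _ _ _ _ _ _ _ _ _ segment_knots[OF j]])
      (subst nth, use j in linarith, rule arg_cong[where f = knot], presburger)+
  finally show ?thesis .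
qed

end

subsection \<open>Products and derivatives of splines\<close>

text \<open>The difference quotient has the same limit within both sets, hence within the union.
  Closedness covers a point of only one set: it is no limit point of the other, so the limit there
  is vacuous.\<close>

lemma has_vector_derivative_within_Un:
  assumes "closed A" "closed B"
    and A: "\<And>x. x \<in> A \<Longrightarrow> (f has_vector_derivative g x) (at x within A)"
    and B: "\<And>x. x \<in> B \<Longrightarrow> (f has_vector_derivative g x) (at x within B)"
    and "x \<in> A \<union> B"
  shows "(f has_vector_derivative g x) (at x within A \<union> B)"
proof -
  have *: "((\<lambda>y. (1 / norm (y - x)) *\<^sub>R (f y - (f x + (y - x) *\<^sub>R g x))) \<longlongrightarrow> 0) (at x within S)"
    if "closed S" and S: "\<And>x. x \<in> S \<Longrightarrow> (f has_vector_derivative g x) (at x within S)" for S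
  proof (cases "x \<in> S")
    case True
    then show ?thesis
      using S[OF True] by (simp add: has_vector_derivative_def has_derivative_within)
  next
    case False
    then have "at x within S = bot"
      using \<open>closed S\<close> not_in_closure_trivial_limitI[of x S] by (simp add: closure_closed)
    then show ?thesis by simp
  qed
  show ?thesis
    using Lim_Un[OF *[OF assms(1) A] *[OF assms(2) B]]
    by (simp add: has_vector_derivative_def has_derivative_within bounded_linear_scaleR_left)
qed

lemma bezier_endpoints [simp]:
  "bezier2 b0 b1 b2 0 = b0" "bezier2 b0 b1 b2 1 = b2"
  "bezier4 b0 b1 b2 b3 b4 0 = b0" "bezier4 b0 b1 b2 b3 b4 1 = b4"
  "bezier5 b0 b1 b2 b3 b4 b5 0 = b0" "bezier5 b0 b1 b2 b3 b4 b5 1 = b5"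
  by (simp_all add: bezier2_def bezier4_def bezier5_def)

lemma bezier4_mult:
  "a * bezier4 b0 b1 b2 b3 b4 s = bezier4 (a * b0) (a * b1) (a * b2) (a * b3) (a * b4) s"
  by (simp add: bezier4_def algebra_simps)

context clamped_partition
begin

definition spline2 :: "(nat \<Rightarrow> complex) \<Rightarrow> real \<Rightarrow> complex" where
  "spline2 c x = (\<Sum>i = 0..m. c i * of_real (bspline (clamped_knots m t 3 1) 2 i x))"

definition spline4 :: "(nat \<Rightarrow> complex) \<Rightarrow> real \<Rightarrow> complex" where
  "spline4 c x = (\<Sum>i = 0..3 * m - 2. c i * of_real (bspline (clamped_knots m t 5 3) 4 i x))"

definition spline5 :: "(nat \<Rightarrow> complex) \<Rightarrow> real \<Rightarrow> complex" where
  "spline5 c x = (\<Sum>i = 0..3 * m - 1. c i * of_real (bspline (clamped_knots m t 6 3) 5 i x))"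

section \<open>Bezier forms on closed segments\<close>

lemma param_left: "param j (t (j + 2)) = 0"
  by (simp add: param_def)

lemma param_right: "j < m - 1 \<Longrightarrow> param j (t (j + 3)) = 1"
  using d_pos[of j] d(1)[of "Suc j"] by (simp add: param_def numeral_eq_Suc)

text \<open>An interior knot belongs to the segment on its right, where its parameter is 0;
  \<open>glue\<close> carries the formula over to parameter 1 of the segment on its left.\<close>

lemma segment_closure_eq:
  assumes S: "\<And>j x. j < m - 1 \<Longrightarrow> x \<in> segment j \<Longrightarrow> S x = B j (param j x)"
    and glue: "\<And>j. B j 1 = B (Suc j) 0"
    and j: "j < m - 1" and x: "x \<in> {t (j + 2)..t (j + 3)}"
  shows "S x = B j (param j x)"
proof (cases "x \<in> segment j")
  case False
  then have xe: "x = t (j + 3)" and j': "Suc j < m - 1"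
    using x j by (auto simp: segment_def)
  have "t (j + 3) < t (j + 4)" using j' by (intro t_less) auto
  then have "x \<in> segment (Suc j)"
    unfolding xe segment_def by (simp add: numeral_eq_Suc)
  then have "S x = B (Suc j) (param (Suc j) x)" using S j' by blast
  moreover have "param (Suc j) x = 0"
    unfolding xe using param_left[of "Suc j"] by (simp add: numeral_eq_Suc)
  moreover have "param j x = 1"
    unfolding xe using j by (rule param_right)
  ultimately show ?thesis by (simp add: glue)
qed (rule S[OF j])

lemma spline2_eq_bezier2:
  assumes "j < m - 1" "x \<in> {t (j + 2)..t (j + 3)}"
  shows "spline2 c x =
    bezier2 (mix j (c j) (c (j + 1))) (c (j + 1)) (mix (Suc j) (c (j + 1)) (c (j + 2))) (param j x)"
  by (rule segment_closure_eq[where S = "spline2 c" and B = "\<lambda>j. bezier2 (mix j (c j) (c (j + 1))) (c (j + 1)) (mix (Suc j) (c (j + 1)) (c (j + 2)))", OF _ _ assms])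
    (erule (1) spline2_segment[folded spline2_def], simp add: numeral_2_eq_2 add.commute)

lemma spline4_eq_bezier4:
  assumes "j < m - 1" "x \<in> {t (j + 2)..t (j + 3)}"
  shows "spline4 c x =
    bezier4 (mix j (c (3 * j)) (c (3 * j + 1))) (c (3 * j + 1)) (c (3 * j + 2)) (c (3 * j + 3))
      (mix (Suc j) (c (3 * j + 3)) (c (3 * j + 4))) (param j x)"
  by (rule segment_closure_eq[where S = "spline4 c" and B = "\<lambda>j. bezier4 (mix j (c (3 * j)) (c (3 * j + 1)))
      (c (3 * j + 1)) (c (3 * j + 2)) (c (3 * j + 3)) (mix (Suc j) (c (3 * j + 3)) (c (3 * j + 4)))", OF _ _ assms])
    (erule (1) spline4_segment[folded spline4_def], simp add: numeral_2_eq_2 add.commute)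

lemma spline5_eq_bezier5:
  assumes "j < m - 1" "x \<in> {t (j + 2)..t (j + 3)}"
  shows "spline5 c x =
    bezier5 (mix j (mix j (c (3 * j)) (c (3 * j + 1))) (mix j (c (3 * j + 1)) (c (3 * j + 2))))
      (mix j (c (3 * j + 1)) (c (3 * j + 2))) (c (3 * j + 2)) (c (3 * j + 3))
      (mix (Suc j) (c (3 * j + 3)) (c (3 * j + 4)))
      (mix (Suc j) (mix (Suc j) (c (3 * j + 3)) (c (3 * j + 4))) (mix (Suc j) (c (3 * j + 4)) (c (3 * j + 5))))
      (param j x)"
  by (rule segment_closure_eq[where S = "spline5 c" and B = "\<lambda>j.
      bezier5 (mix j (mix j (c (3 * j)) (c (3 * j + 1))) (mix j (c (3 * j + 1)) (c (3 * j + 2))))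
      (mix j (c (3 * j + 1)) (c (3 * j + 2))) (c (3 * j + 2)) (c (3 * j + 3))
      (mix (Suc j) (c (3 * j + 3)) (c (3 * j + 4)))
      (mix (Suc j) (mix (Suc j) (c (3 * j + 3)) (c (3 * j + 4))) (mix (Suc j) (c (3 * j + 4)) (c (3 * j + 5))))", OF _ _ assms])
    (erule (1) spline5_segment[folded spline5_def], simp add: numeral_2_eq_2 add.commute)

lemma spline2_mult_spline2:
  assumes p: "\<And>j. j < m \<Longrightarrow> 2 * p (3 * j) =
        z j * mix j (w j) (w (j + 1)) + w j * mix j (z j) (z (j + 1))"
      "\<And>j. j < m \<Longrightarrow> 2 * p (3 * j + 1) =
        z (j + 1) * mix j (w j) (w (j + 1)) + w (j + 1) * mix j (z j) (z (j + 1))"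
      "\<And>j. j < m - 1 \<Longrightarrow> 6 * p (3 * j + 2) = 4 * (z (j + 1) * w (j + 1))
        + mix j (z j) (z (j + 1)) * mix (Suc j) (w (j + 1)) (w (j + 2))
        + mix j (w j) (w (j + 1)) * mix (Suc j) (z (j + 1)) (z (j + 2))"
    and j: "j < m - 1" and x: "x \<in> {t (j + 2)..t (j + 3)}"
  shows "spline2 z x * spline2 w x = spline4 p x"
proof -
  \<comment> \<open>The right-hand sides of \<open>p(1,2)\<close> are linear in the pairs z_j, w_j
    and z_{j+1}, w_{j+1}; averaging them therefore gives the product of the two averages
    twice.\<close>
  have mix_p: "mix j (p (3 * j)) (p (3 * j + 1)) = mix j (z j) (z (j + 1)) * mix j (w j) (w (j + 1))"
    if "j < m" for j
  proof -
    have "2 * mix j (p (3 * j)) (p (3 * j + 1)) = of_real (ratio j) * (2 * p (3 * j)) + (1 - of_real (ratio j)) * (2 * p (3 * j + 1))"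
      by (simp add: mix_def algebra_simps)
    also have "\<dots> = 2 * (mix j (z j) (z (j + 1)) * mix j (w j) (w (j + 1)))"
      unfolding p(1,2)[OF that] by (simp add: mix_def algebra_simps)
    finally show ?thesis by simp
  qed
  have e: "3 * Suc j = 3 * j + 3" "3 * j + 3 + 1 = 3 * j + 4" "Suc j + 1 = j + 2" by simp_all
  have j': "j < m" "Suc j < m" using j by auto
  have mix_p2: "mix (Suc j) (p (3 * j + 3)) (p (3 * j + 4)) =
      mix (Suc j) (z (j + 1)) (z (j + 2)) * mix (Suc j) (w (j + 1)) (w (j + 2))"
    using mix_p[OF j'(2)] unfolding e by simp
  note p_j = p(2)[OF j'(1)] p(3)[OF j] p(1)[OF j'(2), unfolded e]
  show ?thesis
    unfolding spline2_eq_bezier2[OF j x] spline4_eq_bezier4[OF j x] mix_p[OF j'(1)] mix_p2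
    by (rule bezier2_mult_bezier2) (use p_j in \<open>simp_all add: algebra_simps\<close>)
qed

text \<open>The premises are the B-spline differentiation rule: the increment belonging to index i
  is (\<open>\<rho> ! (i + 6) - \<rho> ! (i + 1)\<close>) / 5 times \<open>p i\<close>. These knots
  are two segments apart for i = 3j and 3j + 1, and one segment apart for i = 3j + 2.\<close>

lemma spline5_has_vector_derivative_segment:
  assumes c: "\<And>j. j < m \<Longrightarrow> c (3 * j + 1) - c (3 * j) = of_real (d j + d (Suc j)) / 5 * p (3 * j)"
      "\<And>j. j < m \<Longrightarrow> c (3 * j + 2) - c (3 * j + 1) = of_real (d j + d (Suc j)) / 5 * p (3 * j + 1)"
      "\<And>j. j < m - 1 \<Longrightarrow> c (3 * j + 3) - c (3 * j + 2) = of_real (d (Suc j)) / 5 * p (3 * j + 2)"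
    and j: "j < m - 1" and x: "x \<in> {t (j + 2)..t (j + 3)}"
  shows "(spline5 c has_vector_derivative spline4 p x) (at x within {t (j + 2)..t (j + 3)})"
proof -
  have e: "3 * Suc j = 3 * j + 3" "3 * j + 3 + 1 = 3 * j + 4" "3 * j + 3 + 2 = 3 * j + 5" by simp_all
  have j': "j < m" "Suc j < m" using j by auto
  let ?h = "complex_of_real (d (Suc j))"
  define c0 c1 c2 c3 c4 c5 where c_def: "c0 = c (3 * j)" "c1 = c (3 * j + 1)" "c2 = c (3 * j + 2)"
    "c3 = c (3 * j + 3)" "c4 = c (3 * j + 4)" "c5 = c (3 * j + 5)"
  define p0 p1 p2 p3 p4 where p_def: "p0 = p (3 * j)" "p1 = p (3 * j + 1)" "p2 = p (3 * j + 2)"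
    "p3 = p (3 * j + 3)" "p4 = p (3 * j + 4)"
  define D0 D1 where "D0 = complex_of_real (d j + d (Suc j))" "D1 = complex_of_real (d (Suc j) + d (Suc (Suc j)))"
  have c': "c1 - c0 = D0 / 5 * p0" "c2 - c1 = D0 / 5 * p1" "c3 - c2 = ?h / 5 * p2"
    "c4 - c3 = D1 / 5 * p3" "c5 - c4 = D1 / 5 * p4"
    using c(1,2)[OF j'(1)] c(3)[OF j] c(1,2)[OF j'(2), unfolded e]
    unfolding c_def p_def D0_D1_def by simp_all
  have h: "0 < d (Suc j)" "0 \<le> d j" "0 \<le> d (Suc (Suc j))"
    using d_pos[OF j] d_nonneg j by auto
  define \<alpha> \<gamma> where "\<alpha> = complex_of_real (ratio j)" "\<gamma> = complex_of_real (ratio (Suc j))"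
  \<comment> \<open>The averaging weights shrink the two-segment lengths to the length of this
    segment. All five control point differences then carry the factor \<open>?h\<close> / 5, which
    the 5 of the hodograph and the chain rule cancel.\<close>
  have "ratio j * (d j + d (Suc j)) = d (Suc j)"
    using h by (simp add: ratio_def)
  moreover have "(1 - ratio (Suc j)) * (d (Suc j) + d (Suc (Suc j))) = d (Suc j)"
    using h by (simp add: ratio_def field_simps)
  ultimately have r: "\<alpha> * D0 = ?h" "(1 - \<gamma>) * D1 = ?h"
    unfolding \<alpha>_\<gamma>_def D0_D1_def by (metis of_real_mult, metis of_real_mult of_real_1 of_real_diff)
  have mix: "mix j = (\<lambda>u v. \<alpha> * u + (1 - \<alpha>) * v)" "mix (Suc j) = (\<lambda>u v. \<gamma> * u + (1 - \<gamma>) * v)"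
    by (simp_all add: fun_eq_iff mix_def \<alpha>_\<gamma>_def)
  let ?b0 = "mix j (mix j c0 c1) (mix j c1 c2)" and ?b1 = "mix j c1 c2"
  let ?b4 = "mix (Suc j) c3 c4" and ?b5 = "mix (Suc j) (mix (Suc j) c3 c4) (mix (Suc j) c4 c5)"
  have "?b1 - ?b0 = \<alpha> * (\<alpha> * (c1 - c0) + (1 - \<alpha>) * (c2 - c1))"
    by (simp add: mix algebra_simps)
  also have "\<dots> = (\<alpha> * D0) / 5 * mix j p0 p1"
    unfolding c' by (simp add: mix field_simps)
  finally have b0: "5 * (?b1 - ?b0) = ?h * mix j p0 p1" unfolding r by (simp only:) simp
  have "c2 - ?b1 = \<alpha> * (c2 - c1)"
    by (simp add: mix algebra_simps)
  also have "\<dots> = (\<alpha> * D0) / 5 * p1" unfolding c' by simp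
  finally have b1: "5 * (c2 - ?b1) = ?h * p1" unfolding r by (simp only:) simp
  have b2: "5 * (c3 - c2) = ?h * p2" unfolding c' by simp
  have "?b4 - c3 = (1 - \<gamma>) * (c4 - c3)"
    by (simp add: mix algebra_simps)
  also have "\<dots> = ((1 - \<gamma>) * D1) / 5 * p3" unfolding c' by simp
  finally have b3: "5 * (?b4 - c3) = ?h * p3" unfolding r by (simp only:) simp
  have "?b5 - ?b4 = (1 - \<gamma>) * (\<gamma> * (c4 - c3) + (1 - \<gamma>) * (c5 - c4))"
    by (simp add: mix algebra_simps)
  also have "\<dots> = ((1 - \<gamma>) * D1) / 5 * mix (Suc j) p3 p4"
    unfolding c' by (simp add: mix field_simps)
  finally have b4: "5 * (?b5 - ?b4) = ?h * mix (Suc j) p3 p4" unfolding r by (simp only:) simp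
  have par: "(param j has_vector_derivative 1 / d (Suc j)) (at x within S)" for S
    unfolding param_def[abs_def] by (auto intro!: derivative_eq_intros)
  have "(bezier5 ?b0 ?b1 c2 c3 ?b4 ?b5 \<circ> param j has_vector_derivative
      (1 / d (Suc j)) *\<^sub>R (5 * bezier4 (?b1 - ?b0) (c2 - ?b1) (c3 - c2) (?b4 - c3) (?b5 - ?b4) (param j x)))
      (at x within {t (j + 2)..t (j + 3)})"
    by (rule vector_diff_chain_within[OF par bezier5_has_vector_derivative])
  also have "(1 / d (Suc j)) *\<^sub>R (5 * bezier4 (?b1 - ?b0) (c2 - ?b1) (c3 - c2) (?b4 - c3) (?b5 - ?b4) (param j x)) =
      spline4 p x"
    unfolding bezier4_mult b0 b1 b2 b3 b4 spline4_eq_bezier4[OF j x]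
    unfolding bezier4_mult[symmetric] p_def[symmetric]
    using h(1) by (simp add: scaleR_conv_of_real)
  finally show ?thesis
    by (rule has_vector_derivative_transform[OF x, rotated])
      (simp add: spline5_eq_bezier5[OF j] c_def)
qed

text \<open>Segments are appended one at a time; at each common knot the two one-sided derivatives
  agree, both being the value of the quartic spline.\<close>

lemma spline5_has_vector_derivative:
  assumes c: "\<And>j. j < m \<Longrightarrow> c (3 * j + 1) - c (3 * j) = of_real (d j + d (Suc j)) / 5 * p (3 * j)"
      "\<And>j. j < m \<Longrightarrow> c (3 * j + 2) - c (3 * j + 1) = of_real (d j + d (Suc j)) / 5 * p (3 * j + 1)"
      "\<And>j. j < m - 1 \<Longrightarrow> c (3 * j + 3) - c (3 * j + 2) = of_real (d (Suc j)) / 5 * p (3 * j + 2)"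
    and x: "x \<in> {t 2..t (m + 1)}"
  shows "(spline5 c has_vector_derivative spline4 p x) (at x within {t 2..t (m + 1)})"
proof -
  note seg = spline5_has_vector_derivative_segment[OF c]
  have "(spline5 c has_vector_derivative spline4 p x) (at x within {t 2..t (n + 3)})"
    if "n < m - 1" "x \<in> {t 2..t (n + 3)}" for n x
    using that
  proof (induction n arbitrary: x)
    case 0
    then show ?case using seg[of 0 x] by (simp add: numeral_2_eq_2)
  next
    case (Suc n)
    have "t 2 \<le> t (n + 3)" "t (n + 3) \<le> t (Suc n + 3)"
      using Suc.prems by (auto intro!: t_mono)
    then have un: "{t 2..t (Suc n + 3)} = {t 2..t (n + 3)} \<union> {t (Suc n + 2)..t (Suc n + 3)}"
      by (auto simp: numeral_eq_Suc)
    show ?case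
      unfolding un
      by (rule has_vector_derivative_within_Un) (use Suc seg[of "Suc n"] un in auto)
  qed
  moreover have "m - 2 + 3 = m + 1" "m - 2 < m - 1" using m by auto
  ultimately show ?thesis using x by metis
qed

text \<open>The ratio at the first knot is 1, so both nested averages collapse to the first
  coefficient; at the last knot it is 0 and they collapse to the last one.\<close>

lemma spline5_left: "spline5 c (t 2) = c 0"
proof -
  have r: "ratio 0 = 1" using d_pos[of 0] d(2) m by (simp add: ratio_def)
  have "t 2 \<in> {t (0 + 2)..t (0 + 3)}" using m by (auto intro!: t_mono)
  from spline5_eq_bezier5[OF _ this, of c] show ?thesis
    using m param_left[of 0, unfolded add_0] by (simp add: mix_def r)
qed

lemma spline5_right: "spline5 c (t (m + 1)) = c (3 * m - 1)"
proof -
  obtain n where n: "m = n + 2" using m by (metis add.commute le_Suc_ex)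
  have r: "ratio (Suc n) = 0" using d(3) by (simp add: ratio_def n)
  have t: "t (m + 1) = t (n + 3)" by (simp add: n numeral_eq_Suc)
  have "t (n + 3) \<in> {t (n + 2)..t (n + 3)}" using n by (auto intro!: t_mono)
  from spline5_eq_bezier5[OF _ this, of c] show ?thesis
    using param_right[of n] n unfolding t by (simp add: mix_def r add.commute)
qed

section \<open>Averages in terms of the d_k, and the coefficients of a product\<close>

lemma d_add_pos: "j < m \<Longrightarrow> 0 < d j + d (Suc j)"
proof (cases "j < m - 1")
  case True
  then show ?thesis using d_pos[of j] d_nonneg[of j] by (simp add: add_nonneg_pos)
next
  case False
  moreover assume "j < m"
  ultimately have "j = Suc (m - 2)" "Suc j = m" using m by auto
  then show ?thesis using d_pos[of "m - 2"] d(3) m by simp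
qed

lemma mix_eq:
  "j < m \<Longrightarrow> mix j u v = (of_real (d (j + 1)) * u + of_real (d j) * v) / of_real (d j + d (j + 1))"
proof -
  assume "j < m"
  then have nz: "d j + d (Suc j) \<noteq> 0" using d_add_pos[of j] by simp
  then have "1 - ratio j = d j / (d j + d (Suc j))"
    by (simp add: ratio_def divide_simps)
  then have "1 - complex_of_real (ratio j) = of_real (d j / (d j + d (Suc j)))"
    by (metis of_real_1 of_real_diff)
  then show ?thesis by (simp add: mix_def ratio_def add_divide_distrib)
qed

text \<open>Explains why the recurrences for l_{3i+1} and l_{3i+2} have no denominators: the length
  from the differentiation rule cancels the one in \<open>mix\<close>.\<close>

lemma d_add_mult_mix:
  assumes "j < m"
  shows "of_real (d j + d (Suc j)) * mix j u v = of_real (d (j + 1)) * u + of_real (d j) * v"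
proof -
  have "complex_of_real (d j + d (Suc j)) \<noteq> 0"
    using d_add_pos[OF assms] by (metis less_irrefl of_real_eq_0_iff)
  then show ?thesis by (simp add: mix_eq[OF assms] del: of_real_add)
qed

lemma mix_0: "mix 0 u v = u"
  using d_pos[of 0] d(2) m by (simp add: mix_def ratio_def)

lemma mix_last: "mix (m - 1) u v = v"
  using m d(3) by (simp add: mix_def ratio_def)

text \<open>
  For \<open>w = z\<close> these are the coefficients \<open>p\<^sub>k\<close>; for \<open>w\<close> the conjugate of \<open>z\<close> they give the speed
  \<open>\<bar>z\<bar>\<^sup>2\<close>. Since \<open>d\<^sub>0 = d\<^sub>m = 0\<close>, the exceptional formulas at both ends are instances of the general ones.
\<close>

definition product_coeff :: "(nat \<Rightarrow> complex) \<Rightarrow> (nat \<Rightarrow> complex) \<Rightarrow> nat \<Rightarrow> complex" where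
  "product_coeff z w i = (let j = i div 3 in
     if i mod 3 = 0 then (z j * mix j (w j) (w (j + 1)) + w j * mix j (z j) (z (j + 1))) / 2
     else if i mod 3 = 1 then (z (j + 1) * mix j (w j) (w (j + 1)) + w (j + 1) * mix j (z j) (z (j + 1))) / 2
     else (4 * (z (j + 1) * w (j + 1))
        + mix j (z j) (z (j + 1)) * mix (Suc j) (w (j + 1)) (w (j + 2))
        + mix j (w j) (w (j + 1)) * mix (Suc j) (z (j + 1)) (z (j + 2))) / 6)"

lemma product_coeff_simps:
  "product_coeff z w (3 * j) = (z j * mix j (w j) (w (j + 1)) + w j * mix j (z j) (z (j + 1))) / 2"
  "product_coeff z w (3 * j + 1) = (z (j + 1) * mix j (w j) (w (j + 1)) + w (j + 1) * mix j (z j) (z (j + 1))) / 2"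
  "product_coeff z w (3 * j + 2) = (4 * (z (j + 1) * w (j + 1))
        + mix j (z j) (z (j + 1)) * mix (Suc j) (w (j + 1)) (w (j + 2))
        + mix j (w j) (w (j + 1)) * mix (Suc j) (z (j + 1)) (z (j + 2))) / 6"
proof -
  have "(3 * j + 1) div 3 = j" "(3 * j + 1) mod 3 = 1" "(3 * j + 2) div 3 = j" "(3 * j + 2) mod 3 = 2"
    by presburger+
  then show
    "product_coeff z w (3 * j) = (z j * mix j (w j) (w (j + 1)) + w j * mix j (z j) (z (j + 1))) / 2"
    "product_coeff z w (3 * j + 1) = (z (j + 1) * mix j (w j) (w (j + 1)) + w (j + 1) * mix j (z j) (z (j + 1))) / 2"
    "product_coeff z w (3 * j + 2) = (4 * (z (j + 1) * w (j + 1))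
        + mix j (z j) (z (j + 1)) * mix (Suc j) (w (j + 1)) (w (j + 2))
        + mix j (w j) (w (j + 1)) * mix (Suc j) (z (j + 1)) (z (j + 2))) / 6"
    by (simp_all only: product_coeff_def Let_def) simp_all
qed

lemma ex_segment:
  assumes "x \<in> {t 2..t (m + 1)}"
  shows "\<exists>j < m - 1. x \<in> {t (j + 2)..t (j + 3)}"
proof -
  have "\<exists>j \<le> n. x \<in> {t (j + 2)..t (j + 3)}" if "x \<in> {t 2..t (n + 3)}" for n
    using that
  proof (induction n)
    case (Suc n)
    show ?case
    proof (cases "x \<le> t (n + 3)")
      case True
      with Suc have "\<exists>j \<le> n. x \<in> {t (j + 2)..t (j + 3)}" by auto
      then show ?thesis using le_SucI by blast
    next
      case False
      with Suc.prems show ?thesis by (intro exI[of _ "Suc n"]) (simp add: numeral_eq_Suc)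
    qed
  qed (simp add: numeral_2_eq_2)
  moreover have "m - 2 + 3 = m + 1" using m by simp
  ultimately obtain j where "j \<le> m - 2" "x \<in> {t (j + 2)..t (j + 3)}" using assms by metis
  moreover have "m - 2 < m - 1" using m by simp
  ultimately show ?thesis using le_less_trans by blast
qed

lemma spline2_mult_spline2_eq:
  "x \<in> {t 2..t (m + 1)} \<Longrightarrow> spline2 z x * spline2 w x = spline4 (product_coeff z w) x"
  by (drule ex_segment, elim exE conjE, rule spline2_mult_spline2) (simp_all only: product_coeff_simps, simp_all)

lemma index_cases:
  assumes "j < m"
  obtains "j = 0" | "j = m - 1" | "j \<in> {1..m - 2}"
  using assms by fastforce

end

subsection \<open>Squares, antiderivatives and arc length\<close>

text \<open>Yields the increment of l_{3i}, with \<open>a\<close>, \<open>b\<close>,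
  \<open>c\<close> the lengths d_{i-1}, d_i, d_{i+1} and \<open>u\<close>, \<open>v\<close>,
  \<open>w\<close> the coefficients z_{i-1}, z_i, z_{i+1}. The primed variables stand for the
  conjugates, treated as independent. Both sides keep the common denominator (a + b)(b + c), so
  nothing is cancelled.\<close>

lemma symmetric_product_expansion:
  fixes a b c u u' v v' w w' :: complex
  shows "b / 5 * ((4 * (v * v') + (b * u + a * v) / (a + b) * ((c * v' + b * w') / (b + c))
      + (b * u' + a * v') / (a + b) * ((c * v + b * w) / (b + c))) / 6) =
    2 * b / 15 * (v * v') + b / (15 * (a + b) * (b + c)) *
      (a * c * (v * v') + b^2 / 2 * (u * w' + w * u') + b * c / 2 * (u * v' + v * u')
       + a * b / 2 * (v * w' + w * v'))"
    (is "_ = _ + _ * ?Q")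
proof -
  define K where "K = (a + b) * (b + c)"
  define Q where "Q = ?Q"
  have "(b * u + a * v) * (c * v' + b * w') + (b * u' + a * v') * (c * v + b * w) =
      2 * (a * c * (v * v')) + b^2 * (u * w' + w * u') + b * c * (u * v' + v * u')
       + a * b * (v * w' + w * v')"
    by (simp add: ring_distribs power2_eq_square mult_ac)
  also have "\<dots> = 2 * Q"
    by (simp add: Q_def ring_distribs)
  finally have "(b * u + a * v) / (a + b) * ((c * v' + b * w') / (b + c))
      + (b * u' + a * v') / (a + b) * ((c * v + b * w) / (b + c)) = 2 * Q / K"
    by (simp add: K_def flip: add_divide_distrib)
  then show ?thesis
    unfolding Q_def[symmetric] mult.assoc[of 15] K_def[symmetric] add.assoc[of "4 * (v * v')"]
    by (simp add: ring_distribs add_divide_distrib mult_ac)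
qed

theorem mainTheorem9:
  fixes m :: nat and t d :: "nat \<Rightarrow> real" and z p r l :: "nat \<Rightarrow> complex"
    and \<mu> \<nu> \<rho> :: "real list" and D :: "real set" and Z :: "real \<Rightarrow> complex"
  assumes m: "m \<ge> 2"
    and t: "t 2 = 0" "strict_mono_on {2..m + 1} t"
    and d: "\<And>k. k \<in> {1..m - 1} \<Longrightarrow> d k = t (k + 2) - t (k + 1)" "d 0 = 0" "d m = 0"
    and knots: "\<mu> = clamped_knots m t 3 1" "\<nu> = clamped_knots m t 5 3" "\<rho> = clamped_knots m t 6 3"
    and D: "D = {t 2..t (m + 1)}"
    and Z: "\<And>x. x \<in> D \<Longrightarrow> Z x = (\<Sum>i = 0..m. z i * of_real (bspline \<mu> 2 i x))"
    and p:
      "p 0 = (z 0)\<^sup>2"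
      "p 1 = z 0 * z 1"
      "p (3 * m - 3) = z (m - 1) * z m"
      "p (3 * m - 2) = (z m)\<^sup>2"
      "\<And>k. k \<in> {1..m - 1} \<Longrightarrow> p (3 * k - 1) = 2 / 3 * (z k)\<^sup>2 + 1 / 3 *
          ((of_real (d k) * z (k - 1) + of_real (d (k - 1)) * z k) / of_real (d (k - 1) + d k)) *
          ((of_real (d (k + 1)) * z k + of_real (d k) * z (k + 1)) / of_real (d k + d (k + 1)))"
      "\<And>k. k \<in> {1..m - 2} \<Longrightarrow> p (3 * k) =
          z k * ((of_real (d (k + 1)) * z k + of_real (d k) * z (k + 1)) / of_real (d k + d (k + 1)))"
      "\<And>k. k \<in> {1..m - 2} \<Longrightarrow> p (3 * k + 1) =
          z (k + 1) * ((of_real (d (k + 1)) * z k + of_real (d k) * z (k + 1)) / of_real (d k + d (k + 1)))"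
    and r:
      "r 1 = r 0 + of_real (d 1) / 5 * (z 0)\<^sup>2"
      "r 2 = r 1 + of_real (d 1) / 5 * (z 0 * z 1)"
      "\<And>i. i \<in> {1..m - 1} \<Longrightarrow> r (3 * i) = r (3 * i - 1) + of_real (d i) / 5 *
          (2 / 3 * (z i)\<^sup>2 + 1 / 3 *
          ((of_real (d i) * z (i - 1) + of_real (d (i - 1)) * z i) / of_real (d (i - 1) + d i)) *
          ((of_real (d (i + 1)) * z i + of_real (d i) * z (i + 1)) / of_real (d i + d (i + 1))))"
      "\<And>i. i \<in> {1..m - 2} \<Longrightarrow> r (3 * i + 1) = r (3 * i) +
          z i / 5 * (of_real (d (i + 1)) * z i + of_real (d i) * z (i + 1))"
      "\<And>i. i \<in> {1..m - 2} \<Longrightarrow> r (3 * i + 2) = r (3 * i + 1) +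
          z (i + 1) / 5 * (of_real (d (i + 1)) * z i + of_real (d i) * z (i + 1))"
      "r (3 * m - 2) = r (3 * m - 3) + of_real (d (m - 1)) / 5 * (z (m - 1) * z m)"
      "r (3 * m - 1) = r (3 * m - 2) + of_real (d (m - 1)) / 5 * (z m)\<^sup>2"
    and l:
      "l 0 = 0"
      "l 1 = l 0 + of_real (d 1) / 5 * (z 0 * cnj (z 0))"
      "l 2 = l 1 + of_real (d 1) / 10 * (z 0 * cnj (z 1) + z 1 * cnj (z 0))"
      "\<And>i. i \<in> {1..m - 1} \<Longrightarrow> l (3 * i) = l (3 * i - 1)
          + of_real (2 * d i / 15) * (z i * cnj (z i))
          + of_real (d i / (15 * (d (i - 1) + d i) * (d i + d (i + 1)))) *
            (of_real (d (i - 1) * d (i + 1)) * (z i * cnj (z i))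
             + of_real ((d i)\<^sup>2 / 2) * (z (i - 1) * cnj (z (i + 1)) + z (i + 1) * cnj (z (i - 1)))
             + of_real (d i * d (i + 1) / 2) * (z (i - 1) * cnj (z i) + z i * cnj (z (i - 1)))
             + of_real (d (i - 1) * d i / 2) * (z i * cnj (z (i + 1)) + z (i + 1) * cnj (z i)))"
      "\<And>i. i \<in> {1..m - 2} \<Longrightarrow> l (3 * i + 1) = l (3 * i) + 1 / 5 *
          (of_real (d (i + 1)) * (z i * cnj (z i))
           + of_real (d i / 2) * (z i * cnj (z (i + 1)) + z (i + 1) * cnj (z i)))"
      "\<And>i. i \<in> {1..m - 2} \<Longrightarrow> l (3 * i + 2) = l (3 * i + 1) + 1 / 5 *
          (of_real (d i) * (z (i + 1) * cnj (z (i + 1)))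
           + of_real (d (i + 1) / 2) * (z i * cnj (z (i + 1)) + z (i + 1) * cnj (z i)))"
      "l (3 * m - 2) = l (3 * m - 3) +
          of_real (d (m - 1)) / 10 * (z (m - 1) * cnj (z m) + z m * cnj (z (m - 1)))"
      "l (3 * m - 1) = l (3 * m - 2) + of_real (d (m - 1)) / 5 * (z m * cnj (z m))"
  shows
    "(\<forall>x\<in>D. (Z x)\<^sup>2 = (\<Sum>k = 0..3 * m - 2. p k * of_real (bspline \<nu> 4 k x))) \<and>
     (\<forall>R :: real \<Rightarrow> complex.
        ((\<forall>x\<in>D. (R has_vector_derivative (Z x)\<^sup>2) (at x within D)) \<and> R (t 2) = r 0) \<longleftrightarrow>
        (\<forall>x\<in>D. R x = (\<Sum>i = 0..3 * m - 1. r i * of_real (bspline \<rho> 5 i x)))) \<and>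
     (\<forall>R :: real \<Rightarrow> complex.
        (\<forall>x\<in>D. (R has_vector_derivative (Z x)\<^sup>2) (at x within D)) \<longrightarrow>
        (\<exists>L. has_arc_length R (t 2) (t (m + 1)) L \<and> complex_of_real L = l (3 * m - 1)))"
proof -
  interpret clamped_partition m t d
    using m t d by unfold_locales auto
  note \<mu> = knots(1) and \<nu> = knots(2) and \<rho> = knots(3)
  have Z': "Z x = spline2 z x" if "x \<in> D" for x
    using Z[OF that] by (simp add: spline2_def \<mu>)
  \<comment> \<open>The basis functions are real, so conjugation acts on the coefficients
    only.\<close>
  have Z_cnj: "cnj (Z x) = spline2 (cnj \<circ> z) x" if "x \<in> D" for x
    using Z[OF that] by (simp add: spline2_def \<mu>)
  have m1: "3 * (m - 1) = 3 * m - 3" "3 * m - 3 + 1 = 3 * m - 2" "3 * m - 3 + 2 = 3 * m - 1" "m - 1 + 1 = m"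
    "Suc (m - 1) = m" using m by auto

  have p0: "p (3 * j) = product_coeff z z (3 * j)" if "j < m" for j
    using that
  proof (cases rule: index_cases)
    case 1
    then show ?thesis unfolding product_coeff_simps using p(1) by (simp add: mix_0 power2_eq_square)
  next
    case 2
    then show ?thesis unfolding product_coeff_simps using p(3) by (simp add: mix_last m1 del: One_nat_def)
  next
    case 3
    then show ?thesis unfolding product_coeff_simps using p(6)[OF 3] unfolding mix_eq[OF that, symmetric] by simp
  qed
  have p1: "p (3 * j + 1) = product_coeff z z (3 * j + 1)" if "j < m" for j
    using that
  proof (cases rule: index_cases)
    case 1
    then show ?thesis unfolding product_coeff_simps using p(2) by (simp add: mix_0)
  next
    case 2
    then show ?thesis unfolding product_coeff_simps using p(4) unfolding 2 m1 mix_last by (simp add: power2_eq_square)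
  next
    case 3
    then show ?thesis unfolding product_coeff_simps using p(7)[OF 3] unfolding mix_eq[OF that, symmetric] by simp
  qed
  have p2: "p (3 * j + 2) = product_coeff z z (3 * j + 2)" if "j < m - 1" for j
  proof -
    have j: "Suc j \<in> {1..m - 1}" "j < m" "Suc j < m" using that by auto
    have e: "3 * Suc j - 1 = 3 * j + 2" "Suc j - 1 = j" "Suc j + 1 = j + 2" "j + 1 = Suc j" by auto
    have "p (3 * j + 2) = 2 / 3 * (z (Suc j))\<^sup>2
        + 1 / 3 * mix j (z j) (z (Suc j)) * mix (Suc j) (z (Suc j)) (z (j + 2))"
      using p(5)[OF j(1)] unfolding mix_eq[OF j(2)] mix_eq[OF j(3)] e .
    then show ?thesis
      unfolding product_coeff_simps e by (simp only:) (simp add: power2_eq_square field_simps)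
  qed
  have p_eq: "p i = product_coeff z z i" if "i \<le> 3 * m - 2" for i
  proof -
    have "\<exists>j. i = 3 * j \<or> i = 3 * j + 1 \<or> i = 3 * j + 2" by presburger
    then obtain j where "i = 3 * j \<or> i = 3 * j + 1 \<or> i = 3 * j + 2" by blast
    then show ?thesis
    proof (elim disjE)
      assume "i = 3 * j"
      then show ?thesis using p0[of j] that m by simp
    next
      assume i: "i = 3 * j + 1"
      then have "j < m" using that m by linarith
      from p1[OF this] show ?thesis unfolding i .
    next
      assume i: "i = 3 * j + 2"
      then have "j < m - 1" using that m by linarith
      from p2[OF this] show ?thesis unfolding i .
    qed
  qed
  have square: "(Z x)\<^sup>2 = spline4 (product_coeff z z) x" if "x \<in> D" for x
    using spline2_mult_spline2_eq[of x z z] that Z'[OF that] by (simp add: D power2_eq_square)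

  \<comment> \<open>The recurrences are brought to the uniform increments of
    \<open>spline5_has_vector_derivative\<close>. At the first and last index one of the two lengths
    is d_0 or d_m and vanishes.\<close>
  have r0: "r (3 * j + 1) - r (3 * j) = of_real (d j + d (Suc j)) / 5 * product_coeff z z (3 * j)" if "j < m" for j
    using that
  proof (cases rule: index_cases)
    case 1
    then show ?thesis unfolding p0[OF that, symmetric] using r(1) p(1) d(2) by simp
  next
    case 2
    show ?thesis unfolding p0[OF that, symmetric] using r(6) p(3) d(3) unfolding 2 m1 by simp
  next
    case 3
    have "complex_of_real (d j + d (Suc j)) \<noteq> 0" using d_add_pos[OF that] by (metis less_numeral_extra(3) of_real_eq_0_iff)
    then show ?thesis unfolding p0[OF that, symmetric] using r(4)[OF 3] p(6)[OF 3] by (simp del: of_real_add)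
  qed
  have r1: "r (3 * j + 2) - r (3 * j + 1) = of_real (d j + d (Suc j)) / 5 * product_coeff z z (3 * j + 1)" if "j < m" for j
    using that
  proof (cases rule: index_cases)
    case 1
    then show ?thesis unfolding p1[OF that, symmetric] using r(2) p(2) d(2) by (simp add: numeral_2_eq_2)
  next
    case 2
    show ?thesis unfolding p1[OF that, symmetric] using r(7) p(4) d(3) unfolding 2 m1 by simp
  next
    case 3
    have "complex_of_real (d j + d (Suc j)) \<noteq> 0" using d_add_pos[OF that] by (metis less_numeral_extra(3) of_real_eq_0_iff)
    then show ?thesis unfolding p1[OF that, symmetric] using r(5)[OF 3] p(7)[OF 3] by (simp del: of_real_add)
  qed
  have r2: "r (3 * j + 3) - r (3 * j + 2) = of_real (d (Suc j)) / 5 * product_coeff z z (3 * j + 2)" if "j < m - 1" for j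
  proof -
    have j: "Suc j \<in> {1..m - 1}" using that by auto
    have e: "3 * Suc j = 3 * j + 3" "3 * j + 3 - 1 = 3 * j + 2" by auto
    show ?thesis
      unfolding p2[OF that, symmetric] using r(3)[OF j] p(5)[OF j] unfolding e by simp
  qed
  have S_deriv: "(spline5 r has_vector_derivative (Z x)\<^sup>2) (at x within D)" if "x \<in> D" for x
    using spline5_has_vector_derivative[of r "product_coeff z z" x, OF r0 r1 r2] that square[OF that]
    by (simp add: D)

  let ?w = "product_coeff z (cnj \<circ> z)"
  \<comment> \<open>Here \<open>y\<close> will be z_j for the increment to l_{3j+1} and z_{j+1} for
    the one to l_{3j+2}.\<close>
  have scaled: "of_real (d j + d (Suc j)) / 5 * ((y * mix j (cnj (z j)) (cnj (z (j + 1))) + cnj y * mix j (z j) (z (j + 1))) / 2) =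
      (y * (of_real (d (j + 1)) * cnj (z j) + of_real (d j) * cnj (z (j + 1)))
        + cnj y * (of_real (d (j + 1)) * z j + of_real (d j) * z (j + 1))) / 10" if "j < m" for y j
    unfolding d_add_mult_mix[OF that, symmetric] by (simp add: field_simps del: of_real_add)
  have l0: "l (3 * j + 1) - l (3 * j) = of_real (d j + d (Suc j)) / 5 * ?w (3 * j)" if "j < m" for j
    using that
  proof (cases rule: index_cases)
    case 1
    then show ?thesis unfolding product_coeff_simps using l(2) d(2) by (simp add: mix_0)
  next
    case 2
    show ?thesis unfolding product_coeff_simps using l(7) d(3) unfolding 2 m1 mix_last by (simp add: field_simps)
  next
    case 3
    show ?thesis unfolding product_coeff_simps comp_apply scaled[OF that] using l(5)[OF 3] by (simp add: field_simps)
  qed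
  have l1: "l (3 * j + 2) - l (3 * j + 1) = of_real (d j + d (Suc j)) / 5 * ?w (3 * j + 1)" if "j < m" for j
    using that
  proof (cases rule: index_cases)
    case 1
    then show ?thesis unfolding product_coeff_simps using l(3) d(2) by (simp add: mix_0 numeral_2_eq_2 field_simps)
  next
    case 2
    show ?thesis unfolding product_coeff_simps using l(8) d(3) unfolding 2 m1 mix_last by (simp add: field_simps)
  next
    case 3
    show ?thesis unfolding product_coeff_simps comp_apply scaled[OF that] using l(6)[OF 3] by (simp add: field_simps)
  qed
  have l2: "l (3 * j + 3) - l (3 * j + 2) = of_real (d (Suc j)) / 5 * ?w (3 * j + 2)" if "j < m - 1" for j
  proof -
    have j: "Suc j \<in> {1..m - 1}" "j < m" "Suc j < m" using that by auto
    have e: "3 * Suc j = 3 * j + 3" "3 * j + 3 - 1 = 3 * j + 2" "Suc j - 1 = j" "Suc j + 1 = j + 2" "j + 1 = Suc j" by auto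
    show ?thesis
      unfolding product_coeff_simps mix_eq[OF j(2)] mix_eq[OF j(3)] e comp_apply
        of_real_add symmetric_product_expansion
      using l(4)[OF j(1)] unfolding e by simp
  qed

  show ?thesis
  proof (intro conjI allI impI ballI)
    fix x assume x: "x \<in> D"
    show "(Z x)\<^sup>2 = (\<Sum>k = 0..3 * m - 2. p k * of_real (bspline \<nu> 4 k x))"
      unfolding square[OF x] spline4_def \<nu> by (intro sum.cong) (simp_all add: p_eq)
  next
    fix R :: "real \<Rightarrow> complex"
    have S: "spline5 r x = (\<Sum>i = 0..3 * m - 1. r i * of_real (bspline \<rho> 5 i x))" for x
      unfolding spline5_def \<rho> ..
    have t2: "t 2 \<in> D" using m by (auto simp: D intro!: t_mono)
    show "((\<forall>x\<in>D. (R has_vector_derivative (Z x)\<^sup>2) (at x within D)) \<and> R (t 2) = r 0) \<longleftrightarrow>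
        (\<forall>x\<in>D. R x = (\<Sum>i = 0..3 * m - 1. r i * of_real (bspline \<rho> 5 i x)))"
      unfolding S[symmetric]
    proof (intro iffI conjI ballI)
      fix x assume R: "(\<forall>x\<in>D. (R has_vector_derivative (Z x)\<^sup>2) (at x within D)) \<and> R (t 2) = r 0" and x: "x \<in> D"
      have "((\<lambda>x. R x - spline5 r x) has_vector_derivative 0) (at y within D)" if "y \<in> D" for y
        using has_vector_derivative_diff[OF _ S_deriv[OF that], of R "(Z y)\<^sup>2"] R that by simp
      then obtain c where c: "\<And>y. y \<in> D \<Longrightarrow> R y - spline5 r y = c"
        using has_vector_derivative_zero_constant[of D "\<lambda>x. R x - spline5 r x"] by (auto simp: D)
      from c[OF t2] R have "c = 0" by (simp add: spline5_left)
      with c[OF x] show "R x = spline5 r x" by simp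
    next
      fix x assume R: "\<forall>x\<in>D. R x = spline5 r x" and x: "x \<in> D"
      show "(R has_vector_derivative (Z x)\<^sup>2) (at x within D)"
        by (rule has_vector_derivative_transform[OF x _ S_deriv[OF x]]) (use R in auto)
    next
      assume R: "\<forall>x\<in>D. R x = spline5 r x"
      then show "R (t 2) = r 0" using t2 by (simp add: spline5_left)
    qed
  next
    fix R :: "real \<Rightarrow> complex"
    assume R: "\<forall>x\<in>D. (R has_vector_derivative (Z x)\<^sup>2) (at x within D)"
    \<comment> \<open>Only on a nondegenerate interval is the derivative within it unique, so that
      \<open>vector_derivative\<close> returns the given one.\<close>
    have lt: "t 2 < t (m + 1)" using m by (intro t_less) auto
    have speed: "norm (vector_derivative R (at x within {t 2..t (m + 1)})) = (norm (Z x))\<^sup>2"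
      if "x \<in> {t 2..t (m + 1)}" for x
      using vector_derivative_within_cbox[OF lt, of x R "(Z x)\<^sup>2"] that R by (simp add: D norm_power)
    \<comment> \<open>The \<open>l\<close> are the coefficients of the quintic antiderivative of the
      speed; it starts at l_0 = 0, so its last coefficient is the whole integral.\<close>
    have "(spline5 l has_vector_derivative of_real ((norm (Z x))\<^sup>2)) (at x within {t 2..t (m + 1)})"
      if "x \<in> {t 2..t (m + 1)}" for x
    proof -
      have "spline4 ?w x = of_real ((norm (Z x))\<^sup>2)"
        unfolding complex_norm_square spline2_mult_spline2_eq[OF that, symmetric]
        using that Z' Z_cnj by (simp add: D)
      with spline5_has_vector_derivative[of l ?w x, OF l0 l1 l2 that] show ?thesis by simp
    qed
    then have "((\<lambda>x. of_real ((norm (Z x))\<^sup>2)) has_integral spline5 l (t (m + 1)) - spline5 l (t 2)) {t 2..t (m + 1)}"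
      using lt by (intro fundamental_theorem_of_calculus) auto
    then have int: "((\<lambda>x. complex_of_real ((norm (Z x))\<^sup>2)) has_integral l (3 * m - 1)) {t 2..t (m + 1)}"
      unfolding spline5_left spline5_right l(1) by (simp only: diff_zero)
    have "((\<lambda>x. (norm (Z x))\<^sup>2) has_integral Re (l (3 * m - 1))) {t 2..t (m + 1)}"
      using has_integral_linear[OF int bounded_linear_Re] by (simp add: o_def)
    then have "has_arc_length R (t 2) (t (m + 1)) (Re (l (3 * m - 1)))"
      unfolding has_arc_length_def by (simp only: has_integral_cong[OF speed])
    \<comment> \<open>The \<open>l\<close> are complex by type; the total is real because the
      imaginary part of the integrand is 0.\<close>
    moreover have "Im (l (3 * m - 1)) = 0"
      using has_integral_linear[OF int bounded_linear_Im] by (simp add: o_def has_integral_0_eq)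
    ultimately show "\<exists>L. has_arc_length R (t 2) (t (m + 1)) L \<and> complex_of_real L = l (3 * m - 1)"
      by (intro exI[of _ "Re (l (3 * m - 1))"]) (simp add: complex_eq_iff)
  qed
qed

end
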